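(* Let $\Omega$ be a quiver. The Tits form is positive definite on the root space of $\Omega$ if and only if the underlying graph of every connected component of $\Omega$ is of the form $A_n$, $D_n$, $E_6$, $E_7$, $E_8$, $A_\infty$, $A_{\infty,\infty}$, or $D_\infty$.
   Context: A quiver $\Omega=(\Omega_0,\Omega_1)$ is a (possibly infinite) set $\Omega_0$ of vertices and a set $\Omega_1$ of ordered pairs of vertices (arrows); for $a=(i,j)$, $s(a)=i$ and $t(a)=j$. Components refer to the underlying undirected graph. $A_n,D_n,E_6,E_7,E_8$ are the finite simply-laced Dynkin diagrams; $A_\infty$ is the one-sided infinite line, $A_{\infty,\infty}$ the two-sided infinite line, and $D_\infty$ has vertices $u,u',v_1,v_2,\dots$ and edges $u-v_1$, $u'-v_1$, $v_j-v_{j+1}$ for $j\ge1$. The root space of $\Omega$ is the set of functions $n:\Omega_0\to\mathbb{Z}$ such that $n_{s(a)}=n_{t(a)}$ for all but finitely many arrows $a$. A subquiver $\Omega'$ of $\Omega$ (not necessarily full) is IC if no connected component of $\Omega$ contains more than one connected component of $\Omega'$. For a finite subquiver $\Omega'$ put $\langle n,n\rangle_{\Omega'}=\sum_{i\in\Omega'_0}n_i^2-\sum_{a\in\Omega'_1}n_{s(a)}n_{t(a)}$. The Tits form $\langle n,n\rangle_\Omega$ is the limit, if it exists, in $\mathbb{Z}\cup\{\pm\infty\}$ (subspace topology from the extended reals), of the net $\Omega'\mapsto\langle n,n\rangle_{\Omega'}$ over the set of finite IC subquivers of $\Omega$ directed by inclusion. The Tits form (or $\Omega$) is positive definite if for each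 nonzero element $n$ of the root space for which this limit exists, $\langle n,n\rangle_\Omega>0$ (possibly $+\infty$). *)

theory Defs
  imports
    "HOL-Library.Extended_Real"
    "HOL-Analysis.Abstract_Limits"
    "Graph_Theory.Digraph_Component"
begin

text \<open>
  A quiver is a \<^typ>\<open>'v pair_pre_digraph\<close> satisfying \<^locale>\<open>pair_wf_digraph\<close>: its arrows are
  ordered pairs of vertices, so loops and pairs of opposite arrows are allowed, and neither set
  need be finite. The notions below are stated for \<^typ>\<open>('v, 'a) pre_digraph\<close>, because that is
  the type on which the library has subgraphs and connectedness; a quiver is viewed there
  through \<^const>\<open>with_proj\<close>.
\<close>

text \<open>
  \<^const>\<open>Digraph_Component.connected\<close> ignores the orientation of the arrows and excludes the
  empty graph.
\<close>

definition components :: "('v, 'a) pre_digraph \<Rightarrow> ('v, 'a) pre_digraph set" where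
  "components G = {K. pre_digraph.max_subgraph G Digraph_Component.connected K}"

definition IC_subquiver :: "('v, 'a) pre_digraph \<Rightarrow> ('v, 'a) pre_digraph \<Rightarrow> bool" where
  "IC_subquiver Q G \<longleftrightarrow> subgraph Q G \<and>
     (\<forall>K \<in> components G. \<forall>C \<in> components Q. \<forall>C' \<in> components Q.
        subgraph C K \<and> subgraph C' K \<longrightarrow> C = C')"

definition finite_IC :: "('v, 'a) pre_digraph \<Rightarrow> ('v, 'a) pre_digraph set" where
  "finite_IC G = {Q. fin_digraph Q \<and> IC_subquiver Q G}"

text \<open>
  The filter of tails of the directed set of finite IC subquivers, so that convergence along
  it is convergence of the net.
\<close>

definition IC_net :: "('v, 'a) pre_digraph \<Rightarrow> ('v, 'a) pre_digraph filter" where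
  "IC_net G = (INF Q \<in> finite_IC G. principal {Q' \<in> finite_IC G. subgraph Q Q'})"

text \<open>
  Functions on the vertex set are represented by functions on the whole type that vanish
  outside it.
\<close>

definition root_space :: "('v, 'a) pre_digraph \<Rightarrow> ('v \<Rightarrow> int) set" where
  "root_space G = {n. (\<forall>i. i \<notin> verts G \<longrightarrow> n i = 0) \<and>
     finite {a \<in> arcs G. n (tail G a) \<noteq> n (head G a)}}"

definition tits_finite :: "('v, 'a) pre_digraph \<Rightarrow> ('v \<Rightarrow> int) \<Rightarrow> int" where
  "tits_finite Q n = (\<Sum>i \<in> verts Q. (n i)\<^sup>2) - (\<Sum>a \<in> arcs Q. n (tail Q a) * n (head Q a))"

definition extended_ints :: "ereal set" where
  "extended_ints = range (\<lambda>k::int. ereal (of_int k)) \<union> {\<infinity>, -\<infinity>}"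

definition tits_limit :: "('v, 'a) pre_digraph \<Rightarrow> ('v \<Rightarrow> int) \<Rightarrow> ereal \<Rightarrow> bool" where
  "tits_limit G n L \<longleftrightarrow>
     limitin (top_of_set extended_ints) (\<lambda>Q. ereal (of_int (tits_finite Q n))) L (IC_net G)"

definition tits_positive_definite :: "('v, 'a) pre_digraph \<Rightarrow> bool" where
  "tits_positive_definite G \<longleftrightarrow>
     (\<forall>n \<in> root_space G. n \<noteq> (\<lambda>_. 0) \<longrightarrow> (\<forall>L. tits_limit G n L \<longrightarrow> L > 0))"

text \<open>
  A simple graph is a pair of a vertex set and a set of two-element sets of vertices. The
  underlying graph of a quiver may have loops and multiple edges: the second conjunct says
  that each edge of the simple graph comes from exactly one arrow and that every arrow
  arises in this way, which rules these out.
\<close>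

definition has_underlying_graph :: "('v, 'a) pre_digraph \<Rightarrow> 'b set \<times> 'b set set \<Rightarrow> bool" where
  "has_underlying_graph Q \<Gamma> \<longleftrightarrow>
     (\<exists>f. bij_betw f (fst \<Gamma>) (verts Q) \<and>
          bij_betw (\<lambda>a. {tail Q a, head Q a}) (arcs Q) ((\<lambda>e. f ` e) ` snd \<Gamma>))"

definition A_graph :: "nat \<Rightarrow> nat set \<times> nat set set" where
  "A_graph n = ({1..n}, {{i, i + 1} | i. 1 \<le> i \<and> i < n})"

definition D_graph :: "nat \<Rightarrow> nat set \<times> nat set set" where
  "D_graph n = ({1..n}, {{i, i + 1} | i. 1 \<le> i \<and> i + 1 < n} \<union> {{n - 2, n}})"

text \<open>Bourbaki numbering: the chain 1, 3, 4, ..., n, with 2 attached to 4.\<close>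

definition E_graph :: "nat \<Rightarrow> nat set \<times> nat set set" where
  "E_graph n = ({1..n}, {{1, 3}, {2, 4}} \<union> {{i, i + 1} | i. 3 \<le> i \<and> i < n})"

definition A_inf_graph :: "nat set \<times> nat set set" where
  "A_inf_graph = (UNIV, {{i, i + 1} | i. True})"

definition A_inf_inf_graph :: "int set \<times> int set set" where
  "A_inf_inf_graph = (UNIV, {{i, i + 1} | i. True})"

text \<open>Here 0 and 1 are the two end vertices, and \<open>j + 1\<close> is the \<open>j\<close>-th vertex of the line.\<close>

definition D_inf_graph :: "nat set \<times> nat set set" where
  "D_inf_graph = (UNIV, {{0, 2}, {1, 2}} \<union> {{j + 1, j + 2} | j. 1 \<le> j})"

end

theory Submission
  imports Defs
begin

text \<open>
Write \<open>q\<^sub>S(n)\<close> for the Tits form of the full subquiver on a finite vertex set \<open>S\<close>.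
The theorem splits into an analytic half, which removes the limit, and a combinatorial half.

\<^emph>\<open>Removing the limit.\<close> The Tits form is positive definite exactly when \<open>q\<^sub>S(n) > 0\<close> for every
finite \<open>S\<close> inside one component and every \<open>n\<close> that does not vanish on \<open>S\<close>
(\<open>positive_definite_iff_components\<close>). If this holds, every finite subquiver, full or not, has
\<open>q(n) \<ge> 1\<close> once it contains a vertex with \<open>n\<^sub>i \<noteq> 0\<close>: deleting arrows can only increase the
form on \<open>\<bar>n\<bar>\<close>. So every limit is at least 1. Conversely let \<open>q\<^sub>S(n) \<le> 0\<close>. A finitely
supported \<open>n\<close> need not lie in the root space, because a vertex may have infinitely many
neighbours; so \<open>n\<close> must be continued over the component without increasing the form. Let \<open>W\<close>
be finite and connected and let \<open>N\<close> be constant along all arrows not inside \<open>W\<close>. Enlarging a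
connected subquiver that contains \<open>W\<close> by a vertex \<open>v\<close> and an arrow adds \<open>N\<^sub>v\<^sup>2 - N\<^sub>v\<^sup>2 = 0\<close>, and by a
further arrow subtracts a square. Hence the net is eventually nonincreasing, its limit exists and
is at most \<open>q\<^sub>W(N)\<close> (\<open>not_positive_definite_witness\<close>). If the component is not a tree, \<open>N\<close> is
its indicator function and \<open>q\<^sub>W(N)\<close> counts vertices minus arrows. If it is a tree, every vertex hangs
off exactly one vertex of \<open>W\<close>, and \<open>N\<close> copies the value there.

\<^emph>\<open>From the list to positivity.\<close> Up to embedding there are three graphs to consider: the two-sided
line, the infinite \<open>D\<close> graph and \<open>E\<^sub>8\<close>. All three forms are sums of squares.

\<^emph>\<open>From positivity to the list.\<close> Evaluating the form on constants shows that every finite set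
of vertices spans fewer arrows than it has vertices. So there are no loops, double edges or cycles, and
finite subtrees can be grown leaf by leaf with full control of the form. Weight 2 on a subtree and
1 on four leaves attached to it gives 0; so there is at most one branching vertex, and it has
three neighbours (\<open>no_four_leaves\<close>). Walking from that vertex, or from any vertex if none branches, without turning back
yields at most three rays that are disjoint and cover the component. The null vectors of the extended
diagrams \<open>E\<^sub>6\<close>, \<open>E\<^sub>7\<close>, \<open>E\<^sub>8\<close> bound the lengths of the rays, and the remaining
combinations of lengths are exactly the graphs in the list.
\<close>

section \<open>Linkage by undirected paths\<close>

definition linked :: "'v rel \<Rightarrow> 'v rel" where
  "linked E = (E \<union> E\<inverse>)\<^sup>*"

abbreviation arcs_in :: "'v rel \<Rightarrow> 'v set \<Rightarrow> 'v rel" where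
  "arcs_in E S \<equiv> E \<inter> S \<times> S"

definition conn :: "'v rel \<Rightarrow> 'v set \<Rightarrow> bool" where
  "conn E S \<longleftrightarrow> S \<times> S \<subseteq> linked (arcs_in E S)"

lemma linked_refl [simp]: "(u, u) \<in> linked E"
  by (simp add: linked_def)

lemma linked_sym: "(u, v) \<in> linked E \<Longrightarrow> (v, u) \<in> linked E"
proof -
  have "sym (linked E)"
    unfolding linked_def by (rule sym_rtrancl) (simp add: sym_Un_converse)
  then show "(u, v) \<in> linked E \<Longrightarrow> (v, u) \<in> linked E"
    by (rule symD)
qed

lemma linked_trans: "(u, v) \<in> linked E \<Longrightarrow> (v, w) \<in> linked E \<Longrightarrow> (u, w) \<in> linked E"
  unfolding linked_def by (rule rtrancl_trans)

lemma linked_mono: "E \<subseteq> F \<Longrightarrow> linked E \<subseteq> linked F"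
  unfolding linked_def by (intro rtrancl_mono) blast

lemma arc_linked: "(u, v) \<in> E \<or> (v, u) \<in> E \<Longrightarrow> (u, v) \<in> linked E"
  unfolding linked_def by blast

lemma linked_induct [consumes 1, case_names base step]:
  assumes "(u, v) \<in> linked E"
    and "P u"
    and "\<And>v w. (u, v) \<in> linked E \<Longrightarrow> (v, w) \<in> E \<or> (w, v) \<in> E \<Longrightarrow> P v \<Longrightarrow> P w"
  shows "P v"
  using assms(1) unfolding linked_def
  by (induction rule: rtrancl_induct) (use assms(2,3) in \<open>auto simp: linked_def\<close>)

lemma linked_crossing:
  assumes "(u, v) \<in> linked E" "u \<in> X" "v \<notin> X"
  obtains x y where "x \<in> X" "y \<notin> X" "(x, y) \<in> E \<or> (y, x) \<in> E"
proof -
  have "v \<in> X \<or> (\<exists>x y. x \<in> X \<and> y \<notin> X \<and> ((x, y) \<in> E \<or> (y, x) \<in> E))"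
    using assms(1) by (induction rule: linked_induct) (use assms(2) in blast)+
  with assms(3) that show thesis by blast
qed

lemma linked_wf:
  assumes "E \<subseteq> V \<times> V" "(u, v) \<in> linked E" "u \<in> V"
  shows "v \<in> V"
  using assms(2) by (induction rule: linked_induct) (use assms in auto)

lemma linked_in_closed:
  assumes "(u, v) \<in> linked E" "u \<in> X"
    and "\<And>x y. (x, y) \<in> E \<Longrightarrow> x \<in> X \<longleftrightarrow> y \<in> X"
  shows "(u, v) \<in> linked (arcs_in E X)" "v \<in> X"
proof -
  have "(u, v) \<in> linked (arcs_in E X) \<and> v \<in> X"
    using assms(1)
  proof (induction rule: linked_induct)
    case base
    then show ?case using assms by simp
  next
    case (step v w)
    then have "w \<in> X" using assms(3) by blast
    moreover have "(v, w) \<in> linked (arcs_in E X)"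
      using step \<open>w \<in> X\<close> by (intro arc_linked) blast
    ultimately show ?case using step linked_trans by metis
  qed
  then show "(u, v) \<in> linked (arcs_in E X)" "v \<in> X" by auto
qed

text \<open>
Between a proper part of a connected set and the rest there is always an arc, so the set can be
reached by adding one adjacent vertex at a time.
\<close>

lemma conn_grow_induct [consumes 4, case_names start step]:
  assumes "finite W'" "conn E W'" "W \<subseteq> W'" "W \<noteq> {}"
    and start: "P W"
    and step: "\<And>X u v. W \<subseteq> X \<Longrightarrow> X \<subseteq> W' \<Longrightarrow> P X \<Longrightarrow> u \<in> X \<Longrightarrow> v \<in> W' \<Longrightarrow> v \<notin> X \<Longrightarrow>
      (u, v) \<in> E \<or> (v, u) \<in> E \<Longrightarrow> P (insert v X)"
  shows "P W'"
proof -
  have "P W'" if "W \<subseteq> X" "X \<subseteq> W'" "P X" for X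
    using that
  proof (induction "card (W' - X)" arbitrary: X rule: less_induct)
    case less
    show ?case
    proof (cases "X = W'")
      case False
      then obtain v where v: "v \<in> W'" "v \<notin> X" using less by blast
      obtain u where u: "u \<in> X" using less(2) assms(4) by blast
      have "(u, v) \<in> linked (arcs_in E W')"
        using assms(2) u v less(3) unfolding conn_def by blast
      then obtain x y where xy: "x \<in> X" "y \<notin> X" "(x, y) \<in> arcs_in E W' \<or> (y, x) \<in> arcs_in E W'"
        using u v by (elim linked_crossing)
      have "P (insert y X)"
        using xy less by (intro step[of X x y]) auto
      moreover have "card (W' - insert y X) < card (W' - X)"
        using xy assms(1) by (intro psubset_card_mono) auto
      ultimately show ?thesis
        using less xy by (intro less(1)[of "insert y X"]) auto
    qed (use less in simp)
  qed
  with assms show ?thesis by blast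
qed

text \<open>
Each new vertex in the growth from a single vertex brings at least one new arc.
\<close>

lemma conn_card:
  assumes "finite S" "conn E S"
  shows "card S \<le> card (arcs_in E S) + 1"
proof (cases "S = {}")
  case False
  then obtain u where u: "u \<in> S" by blast
  have u': "{u} \<subseteq> S" "{u} \<noteq> {}" using u by auto
  have "card S \<le> card (arcs_in E S) + 1"
    using assms u'
  proof (induction rule: conn_grow_induct)
    case start
    show ?case by simp
  next
    case (step X x y)
    have fin: "finite X"
      using step.hyps(2) assms(1) by (rule finite_subset)
    then have "finite (arcs_in E (insert y X))"
      by simp
    moreover have "arcs_in E X \<subset> arcs_in E (insert y X)"
      using step.hyps(3-) by blast
    ultimately have "card (arcs_in E X) < card (arcs_in E (insert y X))"
      by (rule psubset_card_mono)
    moreover have "card (insert y X) = Suc (card X)"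
      using step.hyps fin by simp
    ultimately show ?case using step.IH by linarith
  qed
  then show ?thesis .
qed simp

lemma conn_Un:
  assumes "conn E P" "conn E Q" "w \<in> P" "w \<in> Q"
  shows "conn E (P \<union> Q)"
proof -
  let ?L = "linked (arcs_in E (P \<union> Q))"
  have "linked (arcs_in E P) \<subseteq> ?L" "linked (arcs_in E Q) \<subseteq> ?L"
    by (intro linked_mono; blast)+
  then have "(x, w) \<in> ?L" if "x \<in> P \<union> Q" for x
    using that assms unfolding conn_def by blast
  then show ?thesis
    unfolding conn_def by (auto intro: linked_trans linked_sym)
qed

lemma conn_singleton: "conn E {u}"
  by (simp add: conn_def)

lemma conn_arc: "(u, v) \<in> E \<or> (v, u) \<in> E \<Longrightarrow> conn E {u, v}"
  by (auto simp: conn_def intro: arc_linked)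

lemma conn_linked: "conn E P \<Longrightarrow> u \<in> P \<Longrightarrow> v \<in> P \<Longrightarrow> (u, v) \<in> linked E"
  using linked_mono[of "arcs_in E P" E] unfolding conn_def by blast

lemma linked_finite_conn:
  assumes "(u, v) \<in> linked E"
  obtains P where "finite P" "conn E P" "u \<in> P" "v \<in> P"
proof -
  have "\<exists>P. finite P \<and> conn E P \<and> u \<in> P \<and> v \<in> P"
    using assms
  proof (induction rule: linked_induct)
    case base
    then show ?case using conn_singleton by (intro exI[of _ "{u}"]) simp
  next
    case (step v w)
    then obtain P where P: "finite P" "conn E P" "u \<in> P" "v \<in> P" by blast
    moreover have "conn E (P \<union> {v, w})"
      using P step conn_arc[of v w E] by (intro conn_Un[of E P "{v, w}" v]) auto
    ultimately show ?case by (intro exI[of _ "P \<union> {v, w}"]) simp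
  qed
  with that show thesis by blast
qed

text \<open>
On a full subquiver this is the IC condition: vertices in the same component of the
quiver lie in the same component of the subquiver.
\<close>

definition link_full :: "'v rel \<Rightarrow> 'v set \<Rightarrow> bool" where
  "link_full E W \<longleftrightarrow> W \<times> W \<inter> linked E \<subseteq> linked (arcs_in E W)"

text \<open>
Vertices are added one by one; each is joined by a path to one old vertex of its
component, if there is any. This is what makes the finite IC subquivers directed.
\<close>

lemma link_full_superset:
  assumes "finite S"
  obtains W where "finite W" "S \<subseteq> W" "\<forall>w\<in>W. \<exists>s\<in>S. (s, w) \<in> linked E" "link_full E W"
proof -
  have "\<exists>W. finite W \<and> S \<subseteq> W \<and> (\<forall>w\<in>W. \<exists>s\<in>S. (s, w) \<in> linked E) \<and> link_full E W"
    using assms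
  proof induction
    case empty
    then show ?case by (intro exI[of _ "{}"]) (simp add: link_full_def)
  next
    case (insert x S)
    then obtain W where W: "finite W" "S \<subseteq> W" "\<And>w. w \<in> W \<Longrightarrow> \<exists>s\<in>S. (s, w) \<in> linked E" "link_full E W"
      by blast
    show ?case
    proof (cases "\<exists>w\<in>W. (w, x) \<in> linked E")
      case True
      then obtain w where w: "w \<in> W" "(w, x) \<in> linked E" by blast
      then obtain P where P: "finite P" "conn E P" "w \<in> P" "x \<in> P"
        by (elim linked_finite_conn)
      let ?L = "linked (arcs_in E (W \<union> P))"
      have sub: "linked (arcs_in E W) \<subseteq> ?L" "linked (arcs_in E P) \<subseteq> ?L"
        by (intro linked_mono; blast)+
      have pw: "(p, w) \<in> ?L" "(p, w) \<in> linked E" if "p \<in> P" for p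
        using that P sub conn_linked[of E P p w] unfolding conn_def by blast+
      have WW: "(p, q) \<in> ?L" if "p \<in> W" "q \<in> W" "(p, q) \<in> linked E" for p q
        using that W(4) sub unfolding link_full_def by blast
      have toW: "\<exists>q\<in>W. (p, q) \<in> ?L \<and> (p, q) \<in> linked E" if "p \<in> W \<union> P" for p
      proof (cases "p \<in> W")
        case True
        then show ?thesis by (intro bexI[of _ p]) simp_all
      next
        case False
        with that show ?thesis using pw w(1) by blast
      qed
      have "link_full E (W \<union> P)"
        unfolding link_full_def
      proof clarify
        fix p q assume pq: "p \<in> W \<union> P" "q \<in> W \<union> P" "(p, q) \<in> linked E"
        obtain p' where p': "p' \<in> W" "(p, p') \<in> ?L" "(p, p') \<in> linked E" using toW pq by blast
        obtain q' where q': "q' \<in> W" "(q, q') \<in> ?L" "(q, q') \<in> linked E" using toW pq by blast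
        have "(p', q') \<in> linked E"
          by (rule linked_trans[OF linked_sym[OF p'(3)] linked_trans[OF pq(3) q'(3)]])
        then have "(p', q') \<in> ?L" using WW p' q' by blast
        then show "(p, q) \<in> ?L"
          by (rule linked_trans[OF p'(2) linked_trans[OF _ linked_sym[OF q'(2)]]])
      qed
      moreover have "\<forall>p\<in>W \<union> P. \<exists>s\<in>insert x S. (s, p) \<in> linked E"
      proof
        fix p assume "p \<in> W \<union> P"
        then obtain q where q: "q \<in> W" "(p, q) \<in> linked E" using toW by blast
        obtain s where s: "s \<in> S" "(s, q) \<in> linked E" using W(3) q by blast
        have "(s, p) \<in> linked E" using s(2) linked_sym[OF q(2)] by (rule linked_trans)
        with s(1) show "\<exists>s\<in>insert x S. (s, p) \<in> linked E" by blast
      qed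
      ultimately show ?thesis
        using W P by (intro exI[of _ "W \<union> P"]) auto
    next
      case False
      have "linked (arcs_in E W) \<subseteq> linked (arcs_in E (insert x W))"
        by (intro linked_mono) blast
      then have "link_full E (insert x W)"
        using W(4) False linked_sym[of _ _ E] linked_refl[of x]
        unfolding link_full_def by blast
      then show ?thesis using W by (intro exI[of _ "insert x W"]) auto
    qed
  qed
  with that show thesis by blast
qed

section \<open>The Tits form on finite vertex sets\<close>

definition tits_sum :: "'v rel \<Rightarrow> 'v set \<Rightarrow> ('v \<Rightarrow> int) \<Rightarrow> int" where
  "tits_sum E S n = (\<Sum>i\<in>S. (n i)\<^sup>2) - (\<Sum>a\<in>arcs_in E S. n (fst a) * n (snd a))"

definition finitely_positive :: "'v set \<Rightarrow> 'v rel \<Rightarrow> bool" where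
  "finitely_positive V E \<longleftrightarrow>
     (\<forall>S n. finite S \<and> S \<subseteq> V \<and> (\<exists>i\<in>S. n i \<noteq> 0) \<longrightarrow> tits_sum E S n > 0)"

lemma finitely_positiveD:
  "finitely_positive V E \<Longrightarrow> finite S \<Longrightarrow> S \<subseteq> V \<Longrightarrow> \<exists>i\<in>S. n i \<noteq> 0 \<Longrightarrow> 0 < tits_sum E S n"
  unfolding finitely_positive_def by blast

lemma tits_sum_ignore_zero:
  assumes "finite S'" "S \<subseteq> S'" "\<And>i. i \<in> S' \<Longrightarrow> i \<notin> S \<Longrightarrow> n i = 0"
  shows "tits_sum E S' n = tits_sum E S n"
proof -
  have "(\<Sum>i\<in>S'. (n i)\<^sup>2) = (\<Sum>i\<in>S. (n i)\<^sup>2)"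
    using assms by (intro sum.mono_neutral_right) auto
  moreover have "(\<Sum>a\<in>arcs_in E S'. n (fst a) * n (snd a)) = (\<Sum>a\<in>arcs_in E S. n (fst a) * n (snd a))"
    using assms by (intro sum.mono_neutral_right) (auto, blast+)
  ultimately show ?thesis by (simp add: tits_sum_def)
qed

lemma tits_sum_cong:
  assumes "arcs_in E S = arcs_in E' S" "\<And>i. i \<in> S \<Longrightarrow> n i = m i"
  shows "tits_sum E S n = tits_sum E' S m"
  unfolding tits_sum_def using assms by (intro arg_cong2[where f = minus] sum.cong) auto

text \<open>
Since \<open>\<bar>n\<bar>\<close> has at most the form value of \<open>n\<close>, one may push \<open>\<bar>n\<bar>\<close> forward along the embedding;
extra arcs in the target then only lower the value. The map \<open>h\<close> on arcs is separate
from \<open>f\<close> because orientations may be reversed.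
\<close>

lemma finitely_positive_embed:
  assumes pos: "finitely_positive V' E'"
    and f: "inj_on f V" "f ` V \<subseteq> V'"
    and h: "inj_on h E" "h ` E \<subseteq> E'"
    and fh: "\<And>u v. (u, v) \<in> E \<Longrightarrow> h (u, v) = (f u, f v) \<or> h (u, v) = (f v, f u)"
  shows "finitely_positive V E"
  unfolding finitely_positive_def
proof clarify
  fix S n i assume S: "finite S" "S \<subseteq> V" "i \<in> S" "(n i :: int) \<noteq> 0"
  define x where "x j = \<bar>n (inv_into S f j)\<bar>" for j
  have injS: "inj_on f S" using f S inj_on_subset by blast
  have x: "x (f j) = \<bar>n j\<bar>" if "j \<in> S" for j
    using that injS by (simp add: x_def)
  have x0: "x j \<ge> 0" for j by (simp add: x_def)
  have "0 < tits_sum E' (f ` S) x"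
    using S f x[OF S(3)] by (intro finitely_positiveD[OF pos]) (auto intro!: bexI[of _ i])
  also have "\<dots> \<le> tits_sum E S n"
  proof -
    have "(\<Sum>j\<in>f ` S. (x j)\<^sup>2) = (\<Sum>j\<in>S. (n j)\<^sup>2)"
      using injS x by (simp add: sum.reindex)
    moreover have "(\<Sum>a\<in>arcs_in E S. n (fst a) * n (snd a)) \<le> (\<Sum>a\<in>arcs_in E' (f ` S). x (fst a) * x (snd a))"
    proof -
      have "(\<Sum>a\<in>arcs_in E S. n (fst a) * n (snd a)) \<le> (\<Sum>a\<in>arcs_in E S. \<bar>n (fst a)\<bar> * \<bar>n (snd a)\<bar>)"
        by (intro sum_mono) (metis abs_ge_self abs_mult)
      also have "\<dots> = (\<Sum>a\<in>arcs_in E S. x (fst (h a)) * x (snd (h a)))"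
        using fh x by (intro sum.cong) (force simp: mult.commute)+
      also have "\<dots> = (\<Sum>a\<in>h ` arcs_in E S. x (fst a) * x (snd a))"
        using inj_on_subset[OF h(1)] by (subst sum.reindex) auto
      also have "\<dots> \<le> (\<Sum>a\<in>arcs_in E' (f ` S). x (fst a) * x (snd a))"
      proof (intro sum_mono2)
        show "h ` arcs_in E S \<subseteq> arcs_in E' (f ` S)"
          using h(2) fh by fastforce
      qed (use S x0 in auto)
      finally show ?thesis .
    qed
    ultimately show ?thesis by (simp add: tits_sum_def)
  qed
  finally show "0 < tits_sum E S n" .
qed

lemma finitely_positive_mono:
  "finitely_positive V' E' \<Longrightarrow> V \<subseteq> V' \<Longrightarrow> E \<subseteq> E' \<Longrightarrow> finitely_positive V E"
  by (rule finitely_positive_embed[where f = id and h = id]) auto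

lemma tits_sum_attach_leaf:
  assumes "finite S" "v \<notin> S" "a = (u, v) \<or> a = (v, u)" "arcs_in E (insert v S) = insert a (arcs_in E S)"
  shows "tits_sum E (insert v S) n = tits_sum E S n + (n v)\<^sup>2 - n u * n v"
proof -
  have "a \<notin> arcs_in E S" using assms by auto
  then show ?thesis
    using assms by (auto simp: tits_sum_def algebra_simps)
qed

section \<open>Components and finite IC subquivers\<close>

definition graph_on :: "'v set \<Rightarrow> 'v rel \<Rightarrow> ('v, 'v \<times> 'v) pre_digraph" where
  "graph_on V E = \<lparr>verts = V, arcs = E, tail = fst, head = snd\<rparr>"

lemma graph_on_simps [simp]:
  "verts (graph_on V E) = V" "arcs (graph_on V E) = E"
  "tail (graph_on V E) = fst" "head (graph_on V E) = snd"
  by (simp_all add: graph_on_def)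

lemma graph_on_eq_iff [simp]: "graph_on V E = graph_on V' E' \<longleftrightarrow> V = V' \<and> E = E'"
  by (auto simp: graph_on_def)

lemma wf_graph_on [simp]: "wf_digraph (graph_on V E) \<longleftrightarrow> E \<subseteq> V \<times> V"
  unfolding wf_digraph_def by auto

lemma subgraph_graph_on [simp]:
  "subgraph (graph_on W F) (graph_on V E) \<longleftrightarrow> W \<subseteq> V \<and> F \<subseteq> E \<and> E \<subseteq> V \<times> V \<and> F \<subseteq> W \<times> W"
  by (auto simp: subgraph_def compatible_def)

lemma subgraph_graph_onE:
  assumes "subgraph H (graph_on V E)"
  obtains W F where "H = graph_on W F"
proof
  show "H = graph_on (verts H) (arcs H)"
    using assms by (auto simp: subgraph_def compatible_def graph_on_def)
qed

lemma connected_graph_on: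
  assumes "E \<subseteq> V \<times> V"
  shows "Digraph_Component.connected (graph_on V E) \<longleftrightarrow> V \<noteq> {} \<and> V \<times> V \<subseteq> linked E"
proof -
  let ?G = "with_proj (mk_symmetric (graph_on V E))"
  have ends: "arcs_ends ?G = E \<union> E\<inverse>"
    by (auto simp: mk_symmetric_def)
  have vs: "verts ?G = V"
    by (simp add: mk_symmetric_def)
  have "wf_digraph ?G"
    using assms by unfold_locales (auto simp: mk_symmetric_def)
  then have "u \<rightarrow>\<^sup>*\<^bsub>?G\<^esub> v \<longleftrightarrow> (u, v) \<in> linked E" if "u \<in> V" for u v
    using that vs ends by (simp only: wf_digraph.reachable_conv' linked_def)
  then show ?thesis
    unfolding Digraph_Component.connected_def strongly_connected_def vs by blast
qed

definition component_of :: "'v rel \<Rightarrow> 'v \<Rightarrow> ('v, 'v \<times> 'v) pre_digraph" where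
  "component_of E u = graph_on (linked E `` {u}) (arcs_in E (linked E `` {u}))"

lemma link_class_closed:
  "(x, y) \<in> E \<Longrightarrow> x \<in> linked E `` {u} \<longleftrightarrow> y \<in> linked E `` {u}"
  by (auto intro: linked_trans arc_linked)

lemma link_class_connected:
  assumes "p \<in> linked E `` {u}" "q \<in> linked E `` {u}"
  shows "(p, q) \<in> linked (arcs_in E (linked E `` {u}))"
proof -
  have "(p, q) \<in> linked E"
    using assms linked_trans linked_sym by fast
  then show ?thesis
    by (rule linked_in_closed(1)) (use assms link_class_closed in fast)+
qed

text \<open>
Two linked vertices remain linked inside their class, so the full subquiver on a class is connected; a
connected subquiver meeting a class is contained in it.
\<close>

lemma components_graph_on:
  assumes wf: "E \<subseteq> V \<times> V"
  shows "components (graph_on V E) = component_of E ` V"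
proof (intro equalityI subsetI)
  fix K assume "K \<in> components (graph_on V E)"
  then have K: "subgraph K (graph_on V E)" "Digraph_Component.connected K"
    and max: "\<And>H. H \<noteq> K \<Longrightarrow> subgraph K H \<Longrightarrow> subgraph H (graph_on V E) \<Longrightarrow> \<not> Digraph_Component.connected H"
    by (auto simp: components_def pre_digraph.max_subgraph_def)
  obtain W F where KWF: "K = graph_on W F"
    using K(1) by (rule subgraph_graph_onE)
  have WF: "W \<subseteq> V" "F \<subseteq> E" "F \<subseteq> W \<times> W" "W \<noteq> {}" "W \<times> W \<subseteq> linked F"
    using K by (auto simp: KWF connected_graph_on)
  obtain u where u: "u \<in> W" using WF(4) by blast
  let ?C = "linked E `` {u}"
  have "W \<subseteq> ?C"
    using u WF(2,5) linked_mono[of F E] by blast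
  moreover have "?C \<subseteq> V"
    using linked_wf[OF wf, of u] u WF(1) by blast
  ultimately have "subgraph K (component_of E u)" "subgraph (component_of E u) (graph_on V E)"
    using WF wf by (auto simp: KWF component_of_def)
  moreover have "Digraph_Component.connected (component_of E u)"
  proof -
    have "?C \<noteq> {}" using linked_refl by fast
    moreover have "?C \<times> ?C \<subseteq> linked (arcs_in E ?C)"
      by (clarify, rule link_class_connected) simp_all
    ultimately show ?thesis
      unfolding component_of_def by (subst connected_graph_on) simp_all
  qed
  ultimately have "component_of E u = K" using max by blast
  then show "K \<in> component_of E ` V" using u WF(1) by blast
next
  fix K assume "K \<in> component_of E ` V"
  then obtain u where u: "u \<in> V" "K = component_of E u" by blast
  let ?C = "linked E `` {u}"
  have CV: "?C \<subseteq> V" using linked_wf[OF wf, of u] u(1) by blast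
  have uC: "u \<in> ?C" by simp
  show "K \<in> components (graph_on V E)"
    unfolding components_def pre_digraph.max_subgraph_def
  proof (intro CollectI conjI allI impI)
    show "subgraph K (graph_on V E)"
      using CV wf by (auto simp: u(2) component_of_def)
    have "?C \<times> ?C \<subseteq> linked (arcs_in E ?C)"
      by (clarify, rule link_class_connected) simp_all
    then show "Digraph_Component.connected K"
      unfolding u(2) component_of_def using uC by (subst connected_graph_on) (simp, blast)
  next
    fix H assume H: "H \<noteq> K \<and> subgraph K H"
    show "\<not> (subgraph H (graph_on V E) \<and> Digraph_Component.connected H)"
    proof
      assume a: "subgraph H (graph_on V E) \<and> Digraph_Component.connected H"
      obtain W F where HWF: "H = graph_on W F"
        using a by (meson subgraph_graph_onE)
      have WF: "W \<subseteq> V" "F \<subseteq> E" "F \<subseteq> W \<times> W" "W \<times> W \<subseteq> linked F"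
        using a connected_graph_on[of F W] by (auto simp: HWF)
      have KH: "?C \<subseteq> W" "arcs_in E ?C \<subseteq> F"
        using H by (auto simp: HWF u(2) component_of_def)
      have "W \<subseteq> ?C"
        using WF(2,4) KH(1) uC linked_mono[of F E] by blast
      then have "H = K"
        using KH WF by (auto simp: HWF u(2) component_of_def)
      with H show False by blast
    qed
  qed
qed

text \<open>
Components of a subquiver \<open>(W, F)\<close> that lie in the same component of \<open>(V, E)\<close> are classes of
vertices that are linked by \<open>E\<close>; they coincide iff the vertices are linked by \<open>F\<close>.
\<close>

lemma finite_IC_graph_on:
  assumes wf: "E \<subseteq> V \<times> V"
  shows "graph_on W F \<in> finite_IC (graph_on V E) \<longleftrightarrow>
    finite W \<and> W \<subseteq> V \<and> F \<subseteq> E \<and> F \<subseteq> W \<times> W \<and> W \<times> W \<inter> linked E \<subseteq> linked F"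
proof -
  have "(\<forall>K \<in> components (graph_on V E). \<forall>C \<in> components (graph_on W F). \<forall>C' \<in> components (graph_on W F).
        subgraph C K \<and> subgraph C' K \<longrightarrow> C = C') \<longleftrightarrow> W \<times> W \<inter> linked E \<subseteq> linked F"
    if WF: "W \<subseteq> V" "F \<subseteq> E" "F \<subseteq> W \<times> W"
  proof -
    have sub: "subgraph (component_of F w) (component_of E u) \<longleftrightarrow> (u, w) \<in> linked E" if "w \<in> W" for u w
    proof
      assume "subgraph (component_of F w) (component_of E u)"
      then have "linked F `` {w} \<subseteq> linked E `` {u}" by (simp add: component_of_def)
      moreover have "w \<in> linked F `` {w}" by simp
      ultimately show "(u, w) \<in> linked E" by blast
    next
      assume uw: "(u, w) \<in> linked E"
      have "linked F `` {w} \<subseteq> linked E `` {u}"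
        using linked_mono[OF WF(2)] linked_trans[OF uw] by blast
      then show "subgraph (component_of F w) (component_of E u)"
        using WF(2) by (auto simp: component_of_def)
    qed
    have eq: "component_of F w = component_of F w' \<longleftrightarrow> (w, w') \<in> linked F" for w w'
    proof
      assume "component_of F w = component_of F w'"
      moreover have "w' \<in> linked F `` {w'}" by simp
      ultimately show "(w, w') \<in> linked F" by (auto simp: component_of_def)
    next
      assume "(w, w') \<in> linked F"
      then have "linked F `` {w} = linked F `` {w'}"
        using linked_trans linked_sym by fast
      then show "component_of F w = component_of F w'" by (simp add: component_of_def)
    qed
    show ?thesis
      unfolding components_graph_on[OF wf] components_graph_on[OF WF(3)]
    proof safe
      fix p q
      assume a: "\<forall>K\<in>component_of E ` V. \<forall>C\<in>component_of F ` W. \<forall>C'\<in>component_of F ` W.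
          subgraph C K \<and> subgraph C' K \<longrightarrow> C = C'"
        and p: "p \<in> W" and q: "q \<in> W" and pq: "(p, q) \<in> linked E"
      have "component_of F p = component_of F q"
        using a p q WF(1) pq sub[OF p, of p] sub[OF q, of p] by auto
      then show "(p, q) \<in> linked F" by (simp add: eq)
    next
      fix u w w'
      assume "W \<times> W \<inter> linked E \<subseteq> linked F" and w: "w \<in> W" "w' \<in> W"
        and s: "subgraph (component_of F w) (component_of E u)" "subgraph (component_of F w') (component_of E u)"
      moreover have "(w, w') \<in> linked E"
        using s unfolding sub[OF w(1)] sub[OF w(2)] using linked_sym linked_trans by fast
      ultimately show "component_of F w = component_of F w'" unfolding eq by blast
    qed
  qed
  moreover have "fin_digraph (graph_on W F)" if "finite W" "F \<subseteq> W \<times> W"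
    using that by unfold_locales (auto intro: finite_subset)
  moreover have "finite W" if "fin_digraph (graph_on W F)"
    using fin_digraph.finite_verts[OF that] by simp
  ultimately show ?thesis
    unfolding finite_IC_def IC_subquiver_def using wf by auto
qed

lemma finite_IC_graph_onE:
  assumes "Q \<in> finite_IC (graph_on V E)"
  obtains W F where "Q = graph_on W F"
  using assms subgraph_graph_onE unfolding finite_IC_def IC_subquiver_def by blast

lemma link_full_finite_IC:
  assumes "E \<subseteq> V \<times> V" "finite W" "W \<subseteq> V" "link_full E W"
  shows "graph_on W (arcs_in E W) \<in> finite_IC (graph_on V E)"
  using assms by (auto simp: finite_IC_graph_on link_full_def)

lemma finite_IC_directed:
  assumes wf: "E \<subseteq> V \<times> V"
    and Q: "Q1 \<in> finite_IC (graph_on V E)" "Q2 \<in> finite_IC (graph_on V E)"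
  shows "\<exists>Q\<in>finite_IC (graph_on V E). subgraph Q1 Q \<and> subgraph Q2 Q"
proof -
  obtain W1 F1 where Q1: "Q1 = graph_on W1 F1" using Q(1) by (rule finite_IC_graph_onE)
  obtain W2 F2 where Q2: "Q2 = graph_on W2 F2" using Q(2) by (rule finite_IC_graph_onE)
  have W12: "finite (W1 \<union> W2)" "W1 \<union> W2 \<subseteq> V"
    and F: "F1 \<subseteq> E" "F1 \<subseteq> W1 \<times> W1" "F2 \<subseteq> E" "F2 \<subseteq> W2 \<times> W2"
    using Q by (auto simp: Q1 Q2 finite_IC_graph_on[OF wf])
  obtain W where W: "finite W" "W1 \<union> W2 \<subseteq> W" "\<forall>w\<in>W. \<exists>s\<in>W1 \<union> W2. (s, w) \<in> linked E" "link_full E W"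
    using link_full_superset[OF W12(1)] by blast
  have "W \<subseteq> V" using W(3) W12(2) linked_wf[OF wf] by blast
  then have "graph_on W (arcs_in E W) \<in> finite_IC (graph_on V E)"
    using link_full_finite_IC[OF wf] W by blast
  moreover have "subgraph Q1 (graph_on W (arcs_in E W))" "subgraph Q2 (graph_on W (arcs_in E W))"
    using W(2) F by (auto simp: Q1 Q2)
  ultimately show ?thesis by blast
qed

section \<open>Limits along the net of finite IC subquivers\<close>

lemma eventually_IC_net:
  assumes wf: "E \<subseteq> V \<times> V"
  shows "eventually P (IC_net (graph_on V E)) \<longleftrightarrow>
    (\<exists>Q\<in>finite_IC (graph_on V E). \<forall>Q'\<in>finite_IC (graph_on V E). subgraph Q Q' \<longrightarrow> P Q')"
proof -
  let ?I = "finite_IC (graph_on V E)"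
  have "graph_on {} {} \<in> ?I"
    by (simp add: finite_IC_graph_on[OF wf])
  then have ne: "?I \<noteq> {}" by blast
  have "eventually P (IC_net (graph_on V E)) \<longleftrightarrow>
    (\<exists>Q\<in>?I. eventually P (principal {Q' \<in> ?I. subgraph Q Q'}))"
    unfolding IC_net_def
  proof (rule eventually_INF_base[OF ne])
    fix Q1 Q2 assume "Q1 \<in> ?I" "Q2 \<in> ?I"
    then obtain Q where Q: "Q \<in> ?I" "subgraph Q1 Q" "subgraph Q2 Q"
      using finite_IC_directed[OF wf] by blast
    then show "\<exists>Q\<in>?I. principal {Q' \<in> ?I. subgraph Q Q'} \<le>
        inf (principal {Q' \<in> ?I. subgraph Q1 Q'}) (principal {Q' \<in> ?I. subgraph Q2 Q'})"
      by (intro bexI[of _ Q]) (auto intro: subgraph_trans)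
  qed
  then show ?thesis by (simp add: eventually_principal Ball_def imp_conjL)
qed

lemma tits_finite_graph_on:
  "F \<subseteq> W \<times> W \<Longrightarrow> tits_finite (graph_on W F) n = tits_sum F W n"
  by (simp add: tits_finite_def tits_sum_def Int_absorb2)

text \<open>
The form is an integer, hence at least 1, on every subquiver containing a fixed vertex with
nonzero value. Directedness of the net then excludes limits below 1.
\<close>

lemma finitely_positive_imp_positive_definite:
  assumes wf: "E \<subseteq> V \<times> V" and pos: "finitely_positive V E"
  shows "tits_positive_definite (graph_on V E)"
  unfolding tits_positive_definite_def
proof (intro ballI impI allI)
  fix n L assume n: "n \<in> root_space (graph_on V E)" "n \<noteq> (\<lambda>_. 0)"
    and L: "tits_limit (graph_on V E) n L"
  let ?I = "finite_IC (graph_on V E)"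
  obtain i where i: "n i \<noteq> 0" "i \<in> V"
    using n unfolding root_space_def by fastforce
  have "link_full E {i}" by (auto simp: link_full_def)
  then have Q0: "graph_on {i} (arcs_in E {i}) \<in> ?I"
    using i(2) by (intro link_full_finite_IC[OF wf]) auto
  have big: "eventually (\<lambda>Q. tits_finite Q n \<ge> 1) (IC_net (graph_on V E))"
    unfolding eventually_IC_net[OF wf]
  proof (intro bexI[OF _ Q0] ballI impI)
    fix Q assume Q: "Q \<in> ?I" "subgraph (graph_on {i} (arcs_in E {i})) Q"
    obtain W F where WF: "Q = graph_on W F" using Q(1) by (rule finite_IC_graph_onE)
    have *: "finite W" "W \<subseteq> V" "F \<subseteq> E" "F \<subseteq> W \<times> W"
      using Q(1) by (auto simp: WF finite_IC_graph_on[OF wf])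
    have "finitely_positive V F"
      using pos * by (auto intro: finitely_positive_mono)
    moreover have "i \<in> W" using Q(2) by (auto simp: WF)
    ultimately have "tits_sum F W n > 0"
      using * i by (intro finitely_positiveD[of V]) auto
    then show "tits_finite Q n \<ge> 1"
      using * by (simp add: WF tits_finite_graph_on)
  qed
  show "L > 0"
  proof (rule ccontr)
    assume "\<not> L > 0"
    then have "L \<le> 0" by simp
    then have "L < 1" by (rule le_less_trans) simp
    moreover have Lset: "L \<in> extended_ints"
      and Lim: "\<And>U. openin (top_of_set extended_ints) U \<Longrightarrow> L \<in> U \<Longrightarrow>
        eventually (\<lambda>Q. ereal (of_int (tits_finite Q n)) \<in> U) (IC_net (graph_on V E))"
      using L by (auto simp: tits_limit_def limitin_def)
    ultimately have "eventually (\<lambda>Q. ereal (of_int (tits_finite Q n)) \<in> extended_ints \<inter> {..<1}) (IC_net (graph_on V E))"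
      by (intro Lim) auto
    with big have "eventually (\<lambda>Q. False) (IC_net (graph_on V E))"
      by eventually_elim auto
    then show False
      unfolding eventually_IC_net[OF wf] using finite_IC_directed[OF wf] by blast
  qed
qed

text \<open>
Growing the smaller subquiver to the larger one, a new vertex \<open>v\<close> contributes \<open>(N v)\<^sup>2\<close>, which is
cancelled by the arc through which it is reached, as \<open>N\<close> takes the same value at the other end. All
other new arcs also lie outside \<open>W\<close> and subtract squares.
\<close>

lemma tits_sum_grow:
  assumes "finite X'" "conn A' X'" "W \<subseteq> X" "X \<subseteq> X'" "W \<noteq> {}" "A \<subseteq> A'" "arcs_in A' W \<subseteq> A"
    and const: "\<And>a b. (a, b) \<in> A' \<Longrightarrow> \<not> (a \<in> W \<and> b \<in> W) \<Longrightarrow> N a = N b"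
  shows "tits_sum A' X' N \<le> tits_sum A X N"
proof -
  have nonneg: "N (fst e) * N (snd e) \<ge> 0" if "e \<in> A'" "\<not> (fst e \<in> W \<and> snd e \<in> W)" for e
    using const[of "fst e" "snd e"] that by simp
  have "X \<noteq> {}" using assms by blast
  with assms(1,2,4) show ?thesis
  proof (induction rule: conn_grow_induct)
    case start
    have "(\<Sum>a\<in>arcs_in A X. N (fst a) * N (snd a)) \<le> (\<Sum>a\<in>arcs_in A' X. N (fst a) * N (snd a))"
    proof (rule sum_mono2)
      show "finite (arcs_in A' X)" using assms by (meson finite_Int finite_SigmaI finite_subset)
      show "arcs_in A X \<subseteq> arcs_in A' X" using assms by blast
      show "0 \<le> N (fst b) * N (snd b)" if "b \<in> arcs_in A' X - arcs_in A X" for b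
      proof (rule nonneg)
        show "b \<in> A'" using that by blast
        show "\<not> (fst b \<in> W \<and> snd b \<in> W)"
        proof
          assume "fst b \<in> W \<and> snd b \<in> W"
          then have "b \<in> arcs_in A' W" using that by (cases b) auto
          then show False using that assms(7) by blast
        qed
      qed
    qed
    then show ?case by (simp add: tits_sum_def)
  next
    case (step Y u v)
    have finY: "finite Y" using step.hyps(2) assms(1) by (rule finite_subset)
    obtain e where e: "e \<in> A'" "e = (u, v) \<or> e = (v, u)" using step.hyps by blast
    have vW: "v \<notin> W" using step.hyps assms(3) by blast
    have uv: "N u = N v" using e const vW by metis
    have eY: "e \<notin> arcs_in A' Y" using e step.hyps by auto
    have "(\<Sum>a\<in>arcs_in A' Y. N (fst a) * N (snd a)) + (N v)\<^sup>2 = (\<Sum>a\<in>insert e (arcs_in A' Y). N (fst a) * N (snd a))"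
      using eY finY e uv by (auto simp: power2_eq_square)
    also have "\<dots> \<le> (\<Sum>a\<in>arcs_in A' (insert v Y). N (fst a) * N (snd a))"
    proof (rule sum_mono2)
      show "finite (arcs_in A' (insert v Y))" using finY by simp
      show "insert e (arcs_in A' Y) \<subseteq> arcs_in A' (insert v Y)" using e step.hyps by auto
      show "0 \<le> N (fst b) * N (snd b)" if "b \<in> arcs_in A' (insert v Y) - insert e (arcs_in A' Y)" for b
        using that vW by (intro nonneg) auto
    qed
    finally have "tits_sum A' (insert v Y) N \<le> tits_sum A' Y N"
      using finY step.hyps by (simp add: tits_sum_def)
    then show ?case using step.IH by linarith
  qed
qed

text \<open>
A nonincreasing net of integers is eventually constant or tends to \<open>-\<infinity>\<close>.
\<close>

lemma antitone_IC_net_limit: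
  assumes wf: "E \<subseteq> V \<times> V" and Q0: "Q0 \<in> finite_IC (graph_on V E)"
    and anti: "\<And>Q Q'. Q \<in> finite_IC (graph_on V E) \<Longrightarrow> Q' \<in> finite_IC (graph_on V E) \<Longrightarrow>
      subgraph Q0 Q \<Longrightarrow> subgraph Q Q' \<Longrightarrow> tits_finite Q' n \<le> tits_finite Q n"
  shows "\<exists>L. tits_limit (graph_on V E) n L \<and> L \<le> ereal (of_int (tits_finite Q0 n))"
proof -
  let ?I = "finite_IC (graph_on V E)" and ?t = "\<lambda>Q. tits_finite Q n"
  define D where "D = {Q \<in> ?I. subgraph Q0 Q}"
  obtain W F where "Q0 = graph_on W F" using Q0 by (rule finite_IC_graph_onE)
  then have Q0D: "Q0 \<in> D"
    using Q0 by (auto simp: D_def finite_IC_graph_on[OF wf])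
  have DI: "Q \<in> ?I" "subgraph Q0 Q" if "Q \<in> D" for Q using that by (auto simp: D_def)
  have DI': "Q' \<in> D" if "Q \<in> D" "Q' \<in> ?I" "subgraph Q Q'" for Q Q'
    using that subgraph_trans by (auto simp: D_def)
  have ints: "ereal (of_int (k :: int)) \<in> extended_ints" for k
    by (auto simp: extended_ints_def)
  have event: "eventually P (IC_net (graph_on V E))"
    if "Q \<in> D" "\<And>Q'. Q' \<in> D \<Longrightarrow> subgraph Q Q' \<Longrightarrow> P Q'" for P Q
    unfolding eventually_IC_net[OF wf] using that DI DI' by blast
  show ?thesis
  proof (cases "\<exists>m. \<forall>Q\<in>D. m \<le> ?t Q")
    case True
    then obtain m where m: "\<And>Q. Q \<in> D \<Longrightarrow> m \<le> ?t Q" by blast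
    obtain Q1 where Q1: "Q1 \<in> D" "\<And>Q. Q \<in> D \<Longrightarrow> nat (?t Q1 - m) \<le> nat (?t Q - m)"
      using ex_has_least_nat[of "\<lambda>Q. Q \<in> D" Q0 "\<lambda>Q. nat (?t Q - m)"] Q0D by blast
    have min: "?t Q1 \<le> ?t Q" if "Q \<in> D" for Q
      using Q1(2)[OF that] m[OF that] m[OF Q1(1)] by linarith
    have "eventually (\<lambda>Q. ?t Q = ?t Q1) (IC_net (graph_on V E))"
    proof (rule event[OF Q1(1)])
      fix Q' assume "Q' \<in> D" "subgraph Q1 Q'"
      then show "?t Q' = ?t Q1"
        using anti[of Q1 Q'] DI Q1(1) min[of Q'] by (intro antisym) auto
    qed
    then have "tits_limit (graph_on V E) n (ereal (of_int (?t Q1)))"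
      unfolding tits_limit_def limitin_def using ints by (auto elim!: eventually_mono)
    moreover have "?t Q1 \<le> ?t Q0" using min[OF Q0D] .
    ultimately show ?thesis by (intro exI[of _ "ereal (of_int (?t Q1))"]) simp
  next
    case False
    have "tits_limit (graph_on V E) n (-\<infinity>)"
      unfolding tits_limit_def limitin_def
    proof (intro conjI allI impI)
      show "-\<infinity> \<in> topspace (top_of_set extended_ints)" by (simp add: extended_ints_def)
    next
      fix U assume U: "openin (top_of_set extended_ints) U \<and> -\<infinity> \<in> U"
      then obtain T where T: "open T" "U = extended_ints \<inter> T" "-\<infinity> \<in> T"
        by (auto simp: openin_open)
      obtain x where x: "{..<ereal x} \<subseteq> T" using open_MInfty[OF T(1,3)] by blast
      obtain Q where Q: "Q \<in> D" "\<not> \<lfloor>x\<rfloor> \<le> ?t Q" using False by blast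
      show "eventually (\<lambda>Q. ereal (of_int (?t Q)) \<in> U) (IC_net (graph_on V E))"
      proof (rule event[OF Q(1)])
        fix Q' assume Q': "Q' \<in> D" "subgraph Q Q'"
        then have "?t Q' \<le> ?t Q" using anti[of Q Q'] DI Q(1) by blast
        then have "of_int (?t Q') < x" using Q(2) by linarith
        then show "ereal (of_int (?t Q')) \<in> U" using x ints T(2) by auto
      qed
    qed
    then show ?thesis by (intro exI[of _ "-\<infinity>"]) simp
  qed
qed

text \<open>
The IC condition makes the part of each subquiver inside the component of \<open>u\<close> connected once it
contains \<open>W\<close>, so the net is nonincreasing from the subquiver on \<open>W\<close> onwards.
\<close>

lemma not_positive_definite_witness:
  assumes wf: "E \<subseteq> V \<times> V" and u: "u \<in> V"
    and W: "finite W" "conn E W" "W \<noteq> {}" "W \<subseteq> linked E `` {u}"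
    and outside: "\<And>i. i \<notin> linked E `` {u} \<Longrightarrow> N i = 0"
    and const: "\<And>a b. (a, b) \<in> E \<Longrightarrow> \<not> (a \<in> W \<and> b \<in> W) \<Longrightarrow> N a = N b"
    and le: "tits_sum E W N \<le> 0" and nz: "N \<noteq> (\<lambda>_. 0)"
  shows "\<not> tits_positive_definite (graph_on V E)"
proof -
  let ?C = "linked E `` {u}" and ?I = "finite_IC (graph_on V E)"
  let ?Q0 = "graph_on W (arcs_in E W)"
  have CV: "?C \<subseteq> V" using linked_wf[OF wf, of u] u by blast
  have "link_full E W" using W(2) by (auto simp: link_full_def conn_def)
  then have Q0: "?Q0 \<in> ?I" using W CV by (intro link_full_finite_IC[OF wf]) auto
  have "{a \<in> E. N (fst a) \<noteq> N (snd a)} \<subseteq> arcs_in E W"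
    using const by force
  then have "finite {a \<in> E. N (fst a) \<noteq> N (snd a)}"
    using W(1) by (meson finite_Int finite_SigmaI finite_subset)
  then have root: "N \<in> root_space (graph_on V E)"
    using outside CV by (auto simp: root_space_def)
  have "tits_finite Q' N \<le> tits_finite Q N"
    if Q: "Q \<in> ?I" and Q': "Q' \<in> ?I" and sub: "subgraph ?Q0 Q" "subgraph Q Q'" for Q Q'
  proof -
    obtain X F where XF: "Q = graph_on X F" using Q by (rule finite_IC_graph_onE)
    obtain X' F' where XF': "Q' = graph_on X' F'" using Q' by (rule finite_IC_graph_onE)
    have a: "finite X" "F \<subseteq> X \<times> X" "arcs_in E W \<subseteq> F" "W \<subseteq> X" "F \<subseteq> F'" "X \<subseteq> X'"
      using Q sub by (auto simp: XF XF' finite_IC_graph_on[OF wf])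
    have b: "finite X'" "F' \<subseteq> X' \<times> X'" "F' \<subseteq> E" "X' \<times> X' \<inter> linked E \<subseteq> linked F'"
      using Q' by (auto simp: XF' finite_IC_graph_on[OF wf])
    have "conn F' (X' \<inter> ?C)"
      unfolding conn_def
    proof clarify
      fix p q assume pq: "p \<in> X'" "q \<in> X'" "(u, p) \<in> linked E" "(u, q) \<in> linked E"
      have "(p, q) \<in> linked E" using pq linked_sym linked_trans by fast
      then have "(p, q) \<in> linked F'" using b(4) pq by blast
      then show "(p, q) \<in> linked (arcs_in F' (X' \<inter> ?C))"
      proof (rule linked_in_closed(1))
        show "p \<in> X' \<inter> ?C" using pq by simp
        show "x \<in> X' \<inter> ?C \<longleftrightarrow> y \<in> X' \<inter> ?C" if "(x, y) \<in> F'" for x y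
          using that b(2,3) link_class_closed[of x y E u] by blast
      qed
    qed
    then have "tits_sum F' (X' \<inter> ?C) N \<le> tits_sum F (X \<inter> ?C) N"
      using a b W const by (intro tits_sum_grow[of _ _ W]) auto
    moreover have "tits_sum F' X' N = tits_sum F' (X' \<inter> ?C) N" "tits_sum F X N = tits_sum F (X \<inter> ?C) N"
      using a(1) b(1) outside by (intro tits_sum_ignore_zero; blast)+
    ultimately show ?thesis using a b by (simp add: XF XF' tits_finite_graph_on)
  qed
  then obtain L where L: "tits_limit (graph_on V E) N L" "L \<le> ereal (of_int (tits_finite ?Q0 N))"
    using antitone_IC_net_limit[OF wf Q0, of N] by blast
  have "tits_finite ?Q0 N = tits_sum E W N"
    by (simp add: tits_finite_graph_on tits_sum_def Int_absorb2)
  then have "L \<le> 0" using L(2) le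
    by (metis ereal_less_eq(3) of_int_le_0_iff order_trans zero_ereal_def)
  then show ?thesis
    unfolding tits_positive_definite_def using root nz L(1) by (meson not_less)
qed

lemma tits_sum_abs_le: "tits_sum E S (\<lambda>i. \<bar>n i\<bar>) \<le> tits_sum E S n"
proof -
  have "(\<Sum>a\<in>arcs_in E S. n (fst a) * n (snd a)) \<le> (\<Sum>a\<in>arcs_in E S. \<bar>n (fst a)\<bar> * \<bar>n (snd a)\<bar>)"
    by (intro sum_mono) (metis abs_ge_self abs_mult)
  then show ?thesis by (simp add: tits_sum_def)
qed

text \<open>
A violating vector has to be turned into an element of the root space. The proof
distinguishes whether the component contains a cycle, in the form of a finite connected set with
at least as many arcs as vertices.
\<close>

lemma positive_definite_imp_finitely_positive:
  assumes wf: "E \<subseteq> V \<times> V" and pd: "tits_positive_definite (graph_on V E)" and u: "u \<in> V"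
  shows "finitely_positive (linked E `` {u}) E"
proof (rule ccontr)
  let ?C = "linked E `` {u}"
  assume "\<not> finitely_positive ?C E"
  then obtain S n i where S: "finite S" "S \<subseteq> ?C" "i \<in> S" "n i \<noteq> 0" "tits_sum E S n \<le> 0"
    unfolding finitely_positive_def not_less[symmetric] by blast
  obtain W where W: "finite W" "S \<subseteq> W" "\<forall>w\<in>W. \<exists>s\<in>S. (s, w) \<in> linked E" "link_full E W"
    using link_full_superset[OF S(1)] by blast
  have WC: "W \<subseteq> ?C"
  proof
    fix w assume "w \<in> W"
    then obtain s where s: "s \<in> S" "(s, w) \<in> linked E" using W(3) by blast
    with S(2) have "(u, s) \<in> linked E" by blast
    then show "w \<in> ?C" using linked_trans[OF _ s(2)] by blast
  qed
  have linkC: "(p, q) \<in> linked E" if "p \<in> ?C" "q \<in> ?C" for p q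
    using that linked_sym linked_trans by fast
  have connW: "conn E W"
    using W(4) WC linkC unfolding conn_def link_full_def by blast
  define m where "m i = (if i \<in> S then \<bar>n i\<bar> else 0)" for i
  have "tits_sum E W m = tits_sum E S m"
    using W S by (intro tits_sum_ignore_zero) (auto simp: m_def)
  also have "\<dots> = tits_sum E S (\<lambda>i. \<bar>n i\<bar>)"
    by (intro tits_sum_cong) (auto simp: m_def)
  finally have m: "tits_sum E W m \<le> 0"
    using tits_sum_abs_le[of E S n] S(5) by linarith
  show False
  proof (cases "\<exists>U. finite U \<and> conn E U \<and> U \<subseteq> ?C \<and> U \<noteq> {} \<and> card U \<le> card (arcs_in E U)")
    case True
    then obtain U where U: "finite U" "conn E U" "U \<subseteq> ?C" "U \<noteq> {}" "card U \<le> card (arcs_in E U)"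
      by blast
    \<comment> \<open>The indicator function of the component: its form is vertices minus arcs.\<close>
    define N :: "'a \<Rightarrow> int" where "N i = (if i \<in> ?C then 1 else 0)" for i
    have "tits_sum E U N = tits_sum E U (\<lambda>_. 1)"
      using U(3) by (intro tits_sum_cong) (auto simp: N_def)
    also have "\<dots> \<le> 0"
      using U(5) by (simp add: tits_sum_def)
    finally have le: "tits_sum E U N \<le> 0" .
    have "N u = 1" by (simp add: N_def)
    then have nz: "N \<noteq> (\<lambda>_. 0)" by (metis zero_neq_one)
    have "N a = N b" if "(a, b) \<in> E" for a b
      using link_class_closed[OF that, of u] by (simp add: N_def)
    then have "\<not> tits_positive_definite (graph_on V E)"
      using U le nz
      by (intro not_positive_definite_witness[OF wf u, of U N]) (auto simp: N_def)
    with pd show False by blast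
  next
    case False
    then have tree: "card (arcs_in E U) < card U"
      if "finite U" "conn E U" "U \<subseteq> ?C" "U \<noteq> {}" for U
      using that not_less by blast
    \<comment> \<open>Removing the arcs inside W splits the tree into pieces hanging off the vertices of W.\<close>
    define F where "F = E - W \<times> W"
    have FE: "linked F \<subseteq> linked E" by (intro linked_mono) (auto simp: F_def)
    have unique: "t = t'" if t: "t \<in> W" "t' \<in> W" "(t, t') \<in> linked F" for t t'
    proof (rule ccontr)
      assume "t \<noteq> t'"
      obtain P where P: "finite P" "conn F P" "t \<in> P" "t' \<in> P"
        using t(3) by (rule linked_finite_conn)
      have "linked (arcs_in F P) \<subseteq> linked (arcs_in E P)"
        by (intro linked_mono) (auto simp: F_def)
      then have connP: "conn E P" using P(2) unfolding conn_def by blast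
      have PC: "P \<subseteq> ?C"
      proof
        fix p assume "p \<in> P"
        then have tp: "(t, p) \<in> linked E" using conn_linked[OF connP P(3)] by blast
        have "(u, t) \<in> linked E" using t(1) WC by blast
        then show "p \<in> ?C" using linked_trans[OF _ tp] by blast
      qed
      \<comment> \<open>W and P share at least two vertices, but F has no arcs inside W, so the union has a cycle.\<close>
      have "card (arcs_in E W) + card (arcs_in F P) = card (arcs_in E W \<union> arcs_in F P)"
        using W(1) P(1) by (intro card_Un_disjoint[symmetric]) (auto simp: F_def)
      also have "\<dots> \<le> card (arcs_in E (W \<union> P))"
        using W(1) P(1) by (intro card_mono) (auto simp: F_def)
      also have "\<dots> < card (W \<union> P)"
        using W(1) P(1,3) WC PC connW connP t(1) by (intro tree conn_Un[of E W P t]) auto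
      finally have "card (arcs_in E W) + card (arcs_in F P) < card (W \<union> P)" .
      moreover have "card {t, t'} \<le> card (W \<inter> P)"
        using W(1) P t by (intro card_mono) auto
      moreover have "card (W \<union> P) + card (W \<inter> P) = card W + card P"
        using card_Un_Int[OF W(1) P(1)] by simp
      ultimately show False
        using conn_card[OF W(1) connW] conn_card[OF P(1,2)] \<open>t \<noteq> t'\<close> by simp
    qed
    \<comment> \<open>Each piece gets the value of m at the vertex of W from which it hangs.\<close>
    define N where "N v = (if \<exists>t\<in>W. (v, t) \<in> linked F
      then m (SOME t. t \<in> W \<and> (v, t) \<in> linked F) else 0)" for v
    have NW: "N v = m v" if "v \<in> W" for v
    proof -
      have "(SOME t. t \<in> W \<and> (v, t) \<in> linked F) = v"
        using that unique by (intro some_equality) auto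
      then show ?thesis using that linked_refl[of v F] unfolding N_def by auto
    qed
    have const: "N a = N b" if "(a, b) \<in> E" "\<not> (a \<in> W \<and> b \<in> W)" for a b
    proof -
      have ab: "(a, b) \<in> linked F" using that by (intro arc_linked) (auto simp: F_def)
      have "(a, t) \<in> linked F \<longleftrightarrow> (b, t) \<in> linked F" for t
        using linked_trans[OF ab, of t] linked_trans[OF linked_sym[OF ab], of t] by blast
      then show ?thesis by (simp add: N_def)
    qed
    have outside: "N v = 0" if "v \<notin> ?C" for v
    proof -
      have False if t: "t \<in> W" "(v, t) \<in> linked F" for t
      proof -
        have ut: "(u, t) \<in> linked E" using t(1) WC by blast
        have "(v, t) \<in> linked E" using t(2) FE by blast
        from linked_trans[OF ut linked_sym[OF this]] show False using \<open>v \<notin> ?C\<close> by blast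
      qed
      then show ?thesis by (auto simp: N_def)
    qed
    have "tits_sum E W N = tits_sum E W m"
      using NW by (intro tits_sum_cong) auto
    then have le: "tits_sum E W N \<le> 0" using m by simp
    have "i \<in> W" using S W by blast
    then have "N i \<noteq> 0" using NW S by (simp add: m_def)
    then have "\<not> tits_positive_definite (graph_on V E)"
      using W connW WC outside const le \<open>i \<in> W\<close>
      by (intro not_positive_definite_witness[OF wf u, of W N]) auto
    with pd show False by blast
  qed
qed

text \<open>
No arc joins different components, so the form is a sum over the components that meet \<open>S\<close>.
\<close>

lemma finitely_positive_if_components:
  assumes pos: "\<And>u. u \<in> V \<Longrightarrow> finitely_positive (linked E `` {u}) E"
  shows "finitely_positive V E"
proof -
  have "tits_sum E S n > 0" if "finite S" "S \<subseteq> V" "\<exists>i\<in>S. n i \<noteq> 0" for S n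
    using that
  proof (induction "card S" arbitrary: S rule: less_induct)
    case less
    obtain i where i: "i \<in> S" "n i \<noteq> 0" using less.prems by blast
    let ?C = "linked E `` {i}"
    let ?S1 = "S \<inter> ?C" and ?S2 = "S - ?C"
    have iC: "i \<in> ?C" by simp
    have pos1: "tits_sum E ?S1 n > 0"
      using less.prems i iC by (intro finitely_positiveD[OF pos[of i]]) auto
    have "tits_sum E ?S2 n \<ge> 0"
    proof (cases "\<exists>j\<in>?S2. n j \<noteq> 0")
      case True
      have "card ?S2 < card S"
        using less.prems(1) i(1) iC by (intro psubset_card_mono) blast+
      then show ?thesis using True less.hyps[of ?S2] less.prems by force
    next
      case False
      then have "tits_sum E ?S2 n = tits_sum E {} n"
        using less.prems by (intro tits_sum_ignore_zero) auto
      then show ?thesis by (simp add: tits_sum_def)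
    qed
    moreover have "tits_sum E S n = tits_sum E ?S1 n + tits_sum E ?S2 n"
    proof -
      have "(\<Sum>j\<in>S. (n j)\<^sup>2) = (\<Sum>j\<in>?S1. (n j)\<^sup>2) + (\<Sum>j\<in>?S2. (n j)\<^sup>2)"
        using less.prems by (intro sum.Int_Diff)
      moreover have "(\<Sum>a\<in>arcs_in E S. n (fst a) * n (snd a)) =
          (\<Sum>a\<in>arcs_in E ?S1 \<union> arcs_in E ?S2. n (fst a) * n (snd a))"
      proof (rule sum.cong)
        show "arcs_in E S = arcs_in E ?S1 \<union> arcs_in E ?S2"
          using link_class_closed[of _ _ E i] by (auto simp del: Image_singleton_iff)
      qed simp
      moreover have "\<dots> = (\<Sum>a\<in>arcs_in E ?S1. n (fst a) * n (snd a)) + (\<Sum>a\<in>arcs_in E ?S2. n (fst a) * n (snd a))"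
        using less.prems by (intro sum.union_disjoint) auto
      ultimately show ?thesis by (simp add: tits_sum_def)
    qed
    ultimately show ?case using pos1 by linarith
  qed
  then show ?thesis unfolding finitely_positive_def by blast
qed

lemma positive_definite_iff_components:
  assumes wf: "E \<subseteq> V \<times> V"
  shows "tits_positive_definite (graph_on V E) \<longleftrightarrow>
    (\<forall>u\<in>V. finitely_positive (linked E `` {u}) E)"
  using finitely_positive_imp_positive_definite[OF wf] finitely_positive_if_components[of V E]
    positive_definite_imp_finitely_positive[OF wf] by blast

section \<open>Positivity of the listed graphs\<close>

text \<open>
A strengthening of positivity that survives attaching a leaf to \<open>u\<close> and moving on to that leaf, as
\<open>x\<^sup>2 / 2 + y\<^sup>2 - x y = y\<^sup>2 / 2 + (x - y)\<^sup>2 / 2\<close>. It gives lines and \<open>D\<close> graphs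
by induction on their length.
\<close>

definition end_bounded :: "'v rel \<Rightarrow> 'v set \<Rightarrow> 'v \<Rightarrow> bool" where
  "end_bounded E S u \<longleftrightarrow> finite S \<and> u \<in> S \<and> (\<forall>n. (n u)\<^sup>2 \<le> 2 * tits_sum E S n) \<and>
     (\<forall>n. (\<exists>i\<in>S. n i \<noteq> 0) \<longrightarrow> 0 < tits_sum E S n)"

lemma end_bounded_singleton: "(u, u) \<notin> E \<Longrightarrow> end_bounded E {u} u"
  by (auto simp: end_bounded_def tits_sum_def)

lemma end_bounded_attach_leaf:
  assumes S: "end_bounded E S u"
    and v: "v \<notin> S" "a = (u, v) \<or> a = (v, u)" "arcs_in E (insert v S) = insert a (arcs_in E S)"
  shows "end_bounded E (insert v S) v"
proof -
  have fin: "finite S" using S by (simp add: end_bounded_def)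
  note leaf = tits_sum_attach_leaf[OF fin v]
  have bound: "(n v)\<^sup>2 + (n u - n v)\<^sup>2 \<le> 2 * tits_sum E (insert v S) n" for n
  proof -
    have "(n u)\<^sup>2 \<le> 2 * tits_sum E S n" using S by (simp add: end_bounded_def)
    then show ?thesis
      unfolding leaf by (simp add: power2_eq_square algebra_simps)
  qed
  have "0 < tits_sum E (insert v S) n" if n: "\<exists>i\<in>insert v S. n i \<noteq> 0" for n
  proof (cases "n v = 0")
    case True
    then have "tits_sum E (insert v S) n = tits_sum E S n" unfolding leaf by simp
    moreover have "\<exists>i\<in>S. n i \<noteq> 0" using n True by blast
    ultimately show ?thesis using S by (simp add: end_bounded_def)
  next
    case False
    then have "0 < (n v)\<^sup>2" by simp
    then show ?thesis using bound[of n] zero_le_power2[of "n u - n v"] by linarith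
  qed
  moreover have "(n v)\<^sup>2 \<le> 2 * tits_sum E (insert v S) n" for n
    using bound[of n] zero_le_power2[of "n u - n v"] by linarith
  ultimately show ?thesis using fin by (simp add: end_bounded_def)
qed

lemma finitely_positive_exhaust:
  assumes "\<And>S. finite S \<Longrightarrow> S \<subseteq> V \<Longrightarrow> \<exists>S'. S \<subseteq> S' \<and> finite S' \<and>
    (\<forall>n. (\<exists>i\<in>S'. n i \<noteq> 0) \<longrightarrow> 0 < tits_sum E S' n)"
  shows "finitely_positive V E"
  unfolding finitely_positive_def
proof clarify
  fix S n i assume S: "finite S" "S \<subseteq> V" "i \<in> S" "(n i :: int) \<noteq> 0"
  obtain S' where S': "S \<subseteq> S'" "finite S'" "\<And>n. \<exists>i\<in>S'. n i \<noteq> 0 \<Longrightarrow> 0 < tits_sum E S' n"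
    using assms[OF S(1,2)] by blast
  define m where "m j = (if j \<in> S then n j else 0)" for j
  have "0 < tits_sum E S' m"
    using S S'(1) by (intro S'(3) bexI[of _ i]) (auto simp: m_def)
  also have "tits_sum E S' m = tits_sum E S m"
    using S' by (intro tits_sum_ignore_zero) (auto simp: m_def)
  also have "\<dots> = tits_sum E S n"
    by (intro tits_sum_cong) (auto simp: m_def)
  finally show "0 < tits_sum E S n" .
qed

definition line_arcs :: "int rel" where
  "line_arcs = {(i, i + 1) | i. True}"

definition D_arcs :: "nat rel" where
  "D_arcs = {(0, 2), (1, 2)} \<union> {(j + 1, j + 2) | j. 1 \<le> j}"

definition E_arcs :: "nat \<Rightarrow> nat rel" where
  "E_arcs n = {(1, 3), (2, 4)} \<union> {(i, i + 1) | i. 3 \<le> i \<and> i < n}"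

lemma finitely_positive_line: "finitely_positive UNIV line_arcs"
proof (rule finitely_positive_exhaust)
  have eb: "end_bounded line_arcs {a..a + int k} (a + int k)" for a k
  proof (induction k)
    case 0
    then show ?case by (simp add: end_bounded_singleton line_arcs_def)
  next
    case (Suc k)
    have "end_bounded line_arcs (insert (a + int k + 1) {a..a + int k}) (a + int k + 1)"
      by (rule end_bounded_attach_leaf[OF Suc, where a = "(a + int k, a + int k + 1)"])
        (auto simp: line_arcs_def)
    moreover have "insert (a + int k + 1) {a..a + int k} = {a..a + int (Suc k)}"
      by auto
    ultimately show ?case by (simp add: algebra_simps)
  qed
  fix S :: "int set" assume S: "finite S"
  define b where "b = Max (insert 0 (abs ` S))"
  have b: "\<bar>i\<bar> \<le> b" if "i \<in> S" for i using that S by (simp add: b_def)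
  have "0 \<le> b" using S by (simp add: b_def)
  then have "end_bounded line_arcs {-b..b} b" using eb[of "-b" "nat (2 * b)"] by simp
  moreover have "S \<subseteq> {-b..b}" using b by fastforce
  ultimately show "\<exists>S'. S \<subseteq> S' \<and> finite S' \<and> (\<forall>n. (\<exists>i\<in>S'. n i \<noteq> 0) \<longrightarrow> 0 < tits_sum line_arcs S' n)"
    by (intro exI[of _ "{-b..b}"]) (auto simp: end_bounded_def)
qed

lemma finitely_positive_D: "finitely_positive UNIV D_arcs"
proof (rule finitely_positive_exhaust)
  have eb: "end_bounded D_arcs {..k + 2} (k + 2)" for k
  proof (induction k)
    case 0
    have in3: "{..2} = {0, 1, 2::nat}" by auto
    have "arcs_in D_arcs {0, 1, 2} = {(0, 2), (1, 2)}" by (auto simp: D_arcs_def)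
    then have q: "2 * tits_sum D_arcs {..2} n = (n 2)\<^sup>2 + (n 2 - n 0 - n 1)\<^sup>2 + (n 0 - n 1)\<^sup>2" for n
      by (simp add: tits_sum_def in3 power2_eq_square algebra_simps)
    have "0 < tits_sum D_arcs {..2} n" if nz: "\<exists>i\<in>{..2}. n i \<noteq> 0" for n
    proof (rule ccontr)
      assume "\<not> 0 < tits_sum D_arcs {..2} n"
      then have "(n 2)\<^sup>2 + (n 2 - n 0 - n 1)\<^sup>2 + (n 0 - n 1)\<^sup>2 \<le> 0" using q[of n] by linarith
      moreover have "0 \<le> (n 2)\<^sup>2" "0 \<le> (n 2 - n 0 - n 1)\<^sup>2" "0 \<le> (n 0 - n 1)\<^sup>2" by simp_all
      ultimately have "(n 2)\<^sup>2 = 0" "(n 2 - n 0 - n 1)\<^sup>2 = 0" "(n 0 - n 1)\<^sup>2 = 0" by linarith+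
      then have "n 2 = 0" "n 0 = 0" "n 1 = 0" by auto
      with nz show False by (auto simp: in3)
    qed
    moreover have "(n 2)\<^sup>2 \<le> 2 * tits_sum D_arcs {..2} n" for n
      unfolding q by simp
    ultimately have "end_bounded D_arcs {..2} 2" by (simp add: end_bounded_def)
    then show ?case by (simp only: add_0)
  next
    case (Suc k)
    have "end_bounded D_arcs (insert (k + 3) {..k + 2}) (k + 3)"
    proof (rule end_bounded_attach_leaf[OF Suc, where a = "(k + 2, k + 3)"])
      have "(k + 2, k + 3) \<in> D_arcs"
        unfolding D_arcs_def by (auto intro!: exI[of _ "k + 1"])
      then show "arcs_in D_arcs (insert (k + 3) {..k + 2}) = insert (k + 2, k + 3) (arcs_in D_arcs {..k + 2})"
        by (auto simp: D_arcs_def)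
    qed auto
    moreover have "insert (k + 3) {..k + 2} = {..Suc k + 2}" by auto
    ultimately show ?case by (simp add: eval_nat_numeral)
  qed
  fix S :: "nat set" assume S: "finite S"
  then obtain k where "S \<subseteq> {..k}" by (meson finite_nat_set_iff_bounded_le subsetI atMost_iff)
  then have "S \<subseteq> {..k + 2}" by fastforce
  then show "\<exists>S'. S \<subseteq> S' \<and> finite S' \<and> (\<forall>n. (\<exists>i\<in>S'. n i \<noteq> 0) \<longrightarrow> 0 < tits_sum D_arcs S' n)"
    using eb[of k] by (intro exI[of _ "{..k + 2}"]) (auto simp: end_bounded_def)
qed

lemma finitely_positive_E8: "finitely_positive {1..8} (E_arcs 8)"
proof (rule finitely_positive_exhaust)
  let ?q = "tits_sum (E_arcs 8) {1..8}"
  have set8: "{1..8} = {1, 2, 3, 4, 5, 6, 7, 8::nat}" by auto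
  have arcs8: "arcs_in (E_arcs 8) {1..8} = {(1, 3), (2, 4), (3, 4), (4, 5), (5, 6), (6, 7), (7, 8)}"
  proof -
    have "{(i, i + 1) | i. 3 \<le> i \<and> i < (8 :: nat)} = (\<lambda>i. (i, i + 1)) ` {3..<8}"
      by auto
    also have "{3..<8} = {3, 4, 5, 6, 7 :: nat}" by auto
    finally show ?thesis by (simp add: E_arcs_def insert_commute)
  qed
  \<comment> \<open>Complete squares along the three arms 2, 1-3 and 8-7-6-5 from their ends towards vertex 4.
    What remains at vertex 4 is 1 - 1/4 - 1/3 - 2/5 = 1/60.\<close>
  have q: "120 * ?q n = 30 * (2 * n 2 - n 4)\<^sup>2 + 30 * (2 * n 1 - n 3)\<^sup>2 + 10 * (3 * n 3 - 2 * n 4)\<^sup>2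
      + 30 * (2 * n 8 - n 7)\<^sup>2 + 10 * (3 * n 7 - 2 * n 6)\<^sup>2 + 5 * (4 * n 6 - 3 * n 5)\<^sup>2
      + 3 * (5 * n 5 - 4 * n 4)\<^sup>2 + 2 * (n 4)\<^sup>2" for n
    unfolding tits_sum_def arcs8 unfolding set8 by (simp add: power2_eq_square algebra_simps)
  have "0 < ?q n" if nz: "\<exists>i\<in>{1..8}. n i \<noteq> 0" for n
  proof (rule ccontr)
    assume "\<not> 0 < ?q n"
    then have le: "120 * ?q n \<le> 0" by linarith
    note sq = zero_le_power2[of "2 * n 2 - n 4"] zero_le_power2[of "2 * n 1 - n 3"]
      zero_le_power2[of "3 * n 3 - 2 * n 4"] zero_le_power2[of "2 * n 8 - n 7"]
      zero_le_power2[of "3 * n 7 - 2 * n 6"] zero_le_power2[of "4 * n 6 - 3 * n 5"]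
      zero_le_power2[of "5 * n 5 - 4 * n 4"] zero_le_power2[of "n 4"]
    have "(n 4)\<^sup>2 = 0" "(2 * n 2 - n 4)\<^sup>2 = 0" "(3 * n 3 - 2 * n 4)\<^sup>2 = 0" "(2 * n 1 - n 3)\<^sup>2 = 0"
      "(5 * n 5 - 4 * n 4)\<^sup>2 = 0" "(4 * n 6 - 3 * n 5)\<^sup>2 = 0" "(3 * n 7 - 2 * n 6)\<^sup>2 = 0"
      "(2 * n 8 - n 7)\<^sup>2 = 0"
      using le sq unfolding q by linarith+
    then have "n 4 = 0" "2 * n 2 = n 4" "3 * n 3 = 2 * n 4" "2 * n 1 = n 3" "5 * n 5 = 4 * n 4"
      "4 * n 6 = 3 * n 5" "3 * n 7 = 2 * n 6" "2 * n 8 = n 7"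
      by simp_all
    then have "n i = 0" if "i \<in> {1, 2, 3, 4, 5, 6, 7, 8}" for i
      using that by auto
    with nz show False unfolding set8 by blast
  qed
  moreover fix S :: "nat set" assume "S \<subseteq> {1..8}"
  ultimately show "\<exists>S'. S \<subseteq> S' \<and> finite S' \<and> (\<forall>n. (\<exists>i\<in>S'. n i \<noteq> 0) \<longrightarrow> 0 < tits_sum (E_arcs 8) S' n)"
    by (intro exI[of _ "{1..8}"]) auto
qed

lemma finitely_positive_E:
  assumes "n \<le> 8"
  shows "finitely_positive {1..n} (E_arcs n)"
  using assms by (intro finitely_positive_mono[OF finitely_positive_E8]) (auto simp: E_arcs_def)

lemma finitely_positive_A:
  assumes "\<And>a. a \<in> E \<Longrightarrow> snd a = Suc (fst a)"
  shows "finitely_positive V E"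
proof (rule finitely_positive_embed[OF finitely_positive_line, where f = int and h = "map_prod int int"])
  show "map_prod int int ` E \<subseteq> line_arcs"
    using assms by (force simp: line_arcs_def)
  show "inj_on (map_prod int int) E"
    by (auto simp: inj_on_def)
qed auto

definition undirected :: "'b rel \<Rightarrow> 'b set set" where
  "undirected P = (\<lambda>(i, j). {i, j}) ` P"

lemma A_graph_undirected: "A_graph n = ({1..n}, undirected {(i, i + 1) | i. 1 \<le> i \<and> i < n})"
  by (auto simp: A_graph_def undirected_def)

lemma D_graph_undirected:
  "D_graph n = ({1..n}, undirected ({(i, i + 1) | i. 1 \<le> i \<and> i + 1 < n} \<union> {(n - 2, n)}))"
  by (auto simp: D_graph_def undirected_def)

lemma E_graph_undirected: "E_graph n = ({1..n}, undirected (E_arcs n))"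
  by (auto simp: E_graph_def undirected_def E_arcs_def)

lemma A_inf_graph_undirected: "A_inf_graph = (UNIV, undirected {(i, i + 1) | i. True})"
  by (auto simp: A_inf_graph_def undirected_def)

lemma A_inf_inf_graph_undirected: "A_inf_inf_graph = (UNIV, undirected line_arcs)"
  by (auto simp: A_inf_inf_graph_def undirected_def line_arcs_def)

lemma D_inf_graph_undirected: "D_inf_graph = (UNIV, undirected D_arcs)"
  by (auto simp: D_inf_graph_def undirected_def D_arcs_def)

text \<open>
Counted from the far end, \<open>D\<^sub>n\<close> is an initial piece of the infinite \<open>D\<close> graph.
\<close>

lemma finitely_positive_Dn:
  fixes n :: nat
  assumes n: "n \<ge> 4"
  shows "finitely_positive {1..n} ({(i, i + 1) | i. 1 \<le> i \<and> i + 1 < n} \<union> {(n - 2, n)})"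
    (is "finitely_positive ?V ?P")
proof -
  define f where "f i = (if i = n then 0 else n - i)" for i
  define h where "h a = (f (snd a), f (fst a))" for a
  have P: "?P \<subseteq> ?V \<times> ?V" using n by auto
  have f: "inj_on f ?V" by (auto simp: inj_on_def f_def)
  show ?thesis
  proof (rule finitely_positive_embed[OF finitely_positive_D f, where h = h])
    show "inj_on h ?P"
    proof (rule inj_onI)
      fix a b assume ab: "a \<in> ?P" "b \<in> ?P" "h a = h b"
      have "fst a \<in> ?V" "snd a \<in> ?V" "fst b \<in> ?V" "snd b \<in> ?V"
        using subsetD[OF P ab(1)] subsetD[OF P ab(2)] by (simp_all only: mem_Times_iff)
      moreover have "f (fst a) = f (fst b)" "f (snd a) = f (snd b)"
        using ab(3) by (simp_all only: h_def prod.inject)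
      ultimately have "fst a = fst b" "snd a = snd b"
        using inj_onD[OF f] by blast+
      then show "a = b" by (rule prod_eqI)
    qed
    show "h ` ?P \<subseteq> D_arcs"
    proof
      fix b assume "b \<in> h ` ?P"
      then obtain a where a: "a \<in> ?P" "b = h a" by blast
      show "b \<in> D_arcs"
      proof (cases "a = (n - 2, n)")
        case True
        then show ?thesis using a n by (simp add: h_def f_def D_arcs_def)
      next
        case False
        then obtain i where i: "1 \<le> i" "i + 1 < n" "a = (i, i + 1)" using a by blast
        define j where "j = n - (i + 1)"
        have "b = (j, j + 1)" "1 \<le> j"
          using i a by (auto simp: h_def f_def j_def)
        then show ?thesis
          by (cases "j = 1") (auto simp: D_arcs_def intro!: exI[of _ "j - 1"])
      qed
    qed
  qed (auto simp: h_def)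
qed

text \<open>
The arcs of the quiver are in bijection with the edges, so sending an arc to the oriented pair
in \<open>P\<close> that represents its edge is injective.
\<close>

lemma underlying_finitely_positive:
  assumes G: "has_underlying_graph (graph_on C F) (X, undirected P)"
    and F: "F \<subseteq> C \<times> C" and P: "P \<subseteq> X \<times> X" "finitely_positive X P"
  shows "finitely_positive C F"
proof -
  obtain f where f: "bij_betw f X C"
    and edges: "bij_betw (\<lambda>a. {fst a, snd a}) F ((\<lambda>e. f ` e) ` undirected P)"
    using G by (auto simp: has_underlying_graph_def)
  let ?g = "inv_into X f"
  define h where "h a = (if (?g (fst a), ?g (snd a)) \<in> P then (?g (fst a), ?g (snd a)) else (?g (snd a), ?g (fst a)))"
    for a
  have g: "bij_betw ?g C X" using f by (rule bij_betw_inv_into)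
  have hP: "h a \<in> P" if a: "a \<in> F" for a
  proof -
    have "{fst a, snd a} \<in> (\<lambda>e. f ` e) ` undirected P"
      using edges a by (auto simp: bij_betw_def)
    then obtain i j where ij: "(i, j) \<in> P" "{fst a, snd a} = {f i, f j}"
      by (auto simp: undirected_def)
    have "?g (f i) = i" "?g (f j) = j"
      using f ij P by (auto simp: bij_betw_def)
    then show ?thesis
      using ij by (auto simp: h_def doubleton_eq_iff)
  qed
  have "inj_on h F"
  proof (rule inj_onI)
    fix a b assume ab: "a \<in> F" "b \<in> F" "h a = h b"
    then have "{?g (fst a), ?g (snd a)} = {?g (fst b), ?g (snd b)}"
      by (auto simp: h_def split: if_splits)
    then have "?g ` {fst a, snd a} = ?g ` {fst b, snd b}" by simp
    moreover have "{fst a, snd a} \<subseteq> C" "{fst b, snd b} \<subseteq> C" using ab F by auto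
    ultimately have "{fst a, snd a} = {fst b, snd b}"
      using g inj_on_image_eq_iff[of ?g C] by (simp only: bij_betw_def)
    then show "a = b"
      using edges ab by (auto simp: bij_betw_def inj_on_def)
  qed
  moreover have "inj_on ?g C" "?g ` C \<subseteq> X" using g by (simp_all add: bij_betw_def)
  moreover have "h ` F \<subseteq> P" using hP by blast
  ultimately show ?thesis
    by (intro finitely_positive_embed[OF P(2), of ?g C h]) (auto simp: h_def)
qed

definition dynkin :: "('v, 'a) pre_digraph \<Rightarrow> bool" where
  "dynkin K \<longleftrightarrow>
    (\<exists>n\<ge>1. has_underlying_graph K (A_graph n)) \<or>
    (\<exists>n\<ge>4. has_underlying_graph K (D_graph n)) \<or>
    has_underlying_graph K (E_graph 6) \<or>
    has_underlying_graph K (E_graph 7) \<or>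
    has_underlying_graph K (E_graph 8) \<or>
    has_underlying_graph K A_inf_graph \<or>
    has_underlying_graph K A_inf_inf_graph \<or>
    has_underlying_graph K D_inf_graph"

lemma dynkin_finitely_positive:
  assumes K: "dynkin (graph_on C F)" and F: "F \<subseteq> C \<times> C"
  shows "finitely_positive C F"
proof -
  have E: "finitely_positive C F"
    if "has_underlying_graph (graph_on C F) (E_graph n)" "4 \<le> n" "n \<le> 8" for n
  proof (rule underlying_finitely_positive[OF _ F])
    show "has_underlying_graph (graph_on C F) ({1..n}, undirected (E_arcs n))"
      using that(1) by (simp only: E_graph_undirected)
    show "E_arcs n \<subseteq> {1..n} \<times> {1..n}" using that(2) by (auto simp: E_arcs_def)
    show "finitely_positive {1..n} (E_arcs n)" using that(3) by (rule finitely_positive_E)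
  qed
  from K show ?thesis
    unfolding dynkin_def
  proof (elim disjE exE conjE)
  fix n assume "has_underlying_graph (graph_on C F) (A_graph n)"
  then show ?thesis
    unfolding A_graph_undirected by (rule underlying_finitely_positive[OF _ F]) (auto intro: finitely_positive_A)
next
  fix n :: nat assume "n \<ge> 4" "has_underlying_graph (graph_on C F) (D_graph n)"
  then show ?thesis
    unfolding D_graph_undirected using finitely_positive_Dn[of n]
    by (intro underlying_finitely_positive[OF _ F]) auto
next
  assume "has_underlying_graph (graph_on C F) (E_graph 6)"
  then show ?thesis by (rule E) simp_all
next
  assume "has_underlying_graph (graph_on C F) (E_graph 7)"
  then show ?thesis by (rule E) simp_all
next
  assume "has_underlying_graph (graph_on C F) (E_graph 8)"
  then show ?thesis by (rule E) simp_all
next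
  assume "has_underlying_graph (graph_on C F) A_inf_graph"
  then show ?thesis
    unfolding A_inf_graph_undirected by (rule underlying_finitely_positive[OF _ F]) (auto intro: finitely_positive_A)
next
  assume "has_underlying_graph (graph_on C F) A_inf_inf_graph"
  then show ?thesis
    unfolding A_inf_inf_graph_undirected
    by (rule underlying_finitely_positive[OF _ F]) (auto intro: finitely_positive_line)
next
  assume "has_underlying_graph (graph_on C F) D_inf_graph"
  then show ?thesis
    unfolding D_inf_graph_undirected
    by (rule underlying_finitely_positive[OF _ F]) (auto intro: finitely_positive_D)
  qed
qed

section \<open>Subtrees of a positive graph\<close>

locale positive_graph =
  fixes C :: "'v set" and F :: "'v rel"
  assumes wf: "F \<subseteq> C \<times> C"
    and pos: "finitely_positive C F"
    and linkC: "C \<times> C \<subseteq> linked F"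
begin

definition adj :: "'v \<Rightarrow> 'v \<Rightarrow> bool" where
  "adj u v \<longleftrightarrow> (u, v) \<in> F \<or> (v, u) \<in> F"

lemma adj_sym: "adj u v \<longleftrightarrow> adj v u"
  by (auto simp: adj_def)

lemma adj_C: "adj u v \<Longrightarrow> u \<in> C" "adj u v \<Longrightarrow> v \<in> C"
  using wf by (auto simp: adj_def)

text \<open>
Evaluate the form at the constant vector 1.
\<close>

lemma card_arcs_less:
  assumes "finite S" "S \<subseteq> C" "S \<noteq> {}"
  shows "card (arcs_in F S) < card S"
proof -
  have "0 < tits_sum F S (\<lambda>_. 1)"
    using assms by (intro finitely_positiveD[OF pos]) auto
  then show ?thesis by (simp add: tits_sum_def)
qed

lemma no_loop: "(u, u) \<notin> F"
proof
  assume u: "(u, u) \<in> F"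
  then have "arcs_in F {u} = {(u, u)}" by auto
  then show False using card_arcs_less[of "{u}"] u wf by auto
qed

lemma no_opposite:
  assumes "(u, v) \<in> F"
  shows "(v, u) \<notin> F"
proof
  assume vu: "(v, u) \<in> F"
  have ne: "u \<noteq> v" using assms no_loop by blast
  have "card {(u, v), (v, u)} \<le> card (arcs_in F {u, v})"
    using assms vu by (intro card_mono) auto
  then show False using card_arcs_less[of "{u, v}"] assms ne wf by auto
qed

lemma adj_irrefl: "\<not> adj u u"
  using no_loop by (simp add: adj_def)

text \<open>
Extremal for \<open>card_arcs_less\<close>: the full subgraph on \<open>S\<close> has as many arcs as a tree.
\<close>

definition tight :: "'v set \<Rightarrow> bool" where
  "tight S \<longleftrightarrow> finite S \<and> S \<subseteq> C \<and> card (arcs_in F S) + 1 = card S"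

lemma tight_singleton: "u \<in> C \<Longrightarrow> tight {u}"
proof -
  have "arcs_in F {u} = {}" using no_loop by blast
  then show "u \<in> C \<Longrightarrow> tight {u}" by (simp add: tight_def)
qed

text \<open>
The new arc already exhausts the bound on the number of arcs, so \<open>v\<close> has no second neighbour
in \<open>S\<close>. This replaces every argument about cycles.
\<close>

lemma tight_attach:
  assumes S: "tight S" and uv: "u \<in> S" "v \<notin> S" "adj u v"
  obtains a where "a = (u, v) \<or> a = (v, u)" "arcs_in F (insert v S) = insert a (arcs_in F S)"
    "tight (insert v S)"
proof -
  obtain a where a: "a = (u, v) \<or> a = (v, u)" "a \<in> F" using uv(3) by (auto simp: adj_def)
  have fin: "finite S" "S \<subseteq> C" and card: "card (arcs_in F S) + 1 = card S"
    using S by (auto simp: tight_def)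
  have v: "v \<in> C" using uv adj_C by blast
  have sub: "insert a (arcs_in F S) \<subseteq> arcs_in F (insert v S)"
    using a uv by auto
  have fin': "finite (arcs_in F (insert v S))" using fin by simp
  have "card (insert a (arcs_in F S)) = card S"
    using a uv fin card by auto
  moreover have "card (arcs_in F (insert v S)) \<le> card S"
    using card_arcs_less[of "insert v S"] fin v uv by simp
  ultimately have eq: "insert a (arcs_in F S) = arcs_in F (insert v S)"
    using card_subset_eq[OF fin' sub] card_mono[OF fin' sub] by simp
  have "tight (insert v S)"
    using \<open>card (insert a (arcs_in F S)) = card S\<close> eq fin v uv by (simp add: tight_def)
  then show thesis using that a eq by metis
qed

lemma tight_insert: "tight S \<Longrightarrow> u \<in> S \<Longrightarrow> v \<notin> S \<Longrightarrow> adj u v \<Longrightarrow> tight (insert v S)"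
  using tight_attach by metis

lemma tight_adj_insert:
  assumes S: "tight S" and uv: "u \<in> S" "v \<notin> S" "adj u v"
    and xy: "x \<in> insert v S" "y \<in> insert v S" "adj x y"
  shows "(x \<in> S \<and> y \<in> S) \<or> (x = u \<and> y = v) \<or> (x = v \<and> y = u)"
proof -
  obtain a where a: "a = (u, v) \<or> a = (v, u)" "arcs_in F (insert v S) = insert a (arcs_in F S)"
    using S uv by (rule tight_attach)
  have "(x, y) \<in> arcs_in F (insert v S) \<or> (y, x) \<in> arcs_in F (insert v S)"
    using xy by (auto simp: adj_def)
  then show ?thesis unfolding a(2) using a(1) by auto
qed

lemma tits_sum_tight_insert:
  assumes S: "tight S" and uv: "u \<in> S" "v \<notin> S" "adj u v"
  shows "tits_sum F (insert v S) n = tits_sum F S n + (n v)\<^sup>2 - n u * n v"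
proof -
  obtain a where a: "a = (u, v) \<or> a = (v, u)" "arcs_in F (insert v S) = insert a (arcs_in F S)"
    using S uv by (rule tight_attach)
  then show ?thesis
    using S uv by (intro tits_sum_attach_leaf) (auto simp: tight_def)
qed

text \<open>
The null vector of the extended \<open>D\<close> diagrams. With \<open>S\<close> a single vertex it excludes vertices with four
neighbours, with \<open>S\<close> a path it excludes two branching vertices.
\<close>

lemma no_four_leaves:
  assumes S: "tight S"
    and x: "x1 \<notin> S" "x2 \<notin> S" "x3 \<notin> S" "x4 \<notin> S" "distinct [x1, x2, x3, x4]"
    and u: "u1 \<in> S" "u2 \<in> S" "u3 \<in> S" "u4 \<in> S" "adj u1 x1" "adj u2 x2" "adj u3 x3" "adj u4 x4"
  shows False
proof -
  define n :: "'v \<Rightarrow> int" where "n v = (if v \<in> S then 2 else 1)" for v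
  have T1: "tight (insert x1 S)" using x u by (intro tight_insert[OF S, of u1]) auto
  have T2: "tight (insert x2 (insert x1 S))" using x u by (intro tight_insert[OF T1, of u2]) auto
  have T3: "tight (insert x3 (insert x2 (insert x1 S)))" using x u by (intro tight_insert[OF T2, of u3]) auto
  have T4: "tight (insert x4 (insert x3 (insert x2 (insert x1 S))))" (is "tight ?T")
    using x u by (intro tight_insert[OF T3, of u4]) auto
  have "tits_sum F S n = tits_sum F S (\<lambda>_. 2)"
    by (intro tits_sum_cong) (auto simp: n_def)
  also have "\<dots> = 4 * (int (card S) - int (card (arcs_in F S)))"
    by (simp add: tits_sum_def)
  also have "\<dots> = 4"
    using S by (simp add: tight_def)
  finally have "tits_sum F S n = 4" .
  moreover have "tits_sum F ?T n = tits_sum F S n - 4"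
    using tits_sum_tight_insert[OF S, of u1 x1 n] tits_sum_tight_insert[OF T1, of u2 x2 n]
      tits_sum_tight_insert[OF T2, of u3 x3 n] tits_sum_tight_insert[OF T3, of u4 x4 n] x u
    by (auto simp: n_def)
  moreover have "0 < tits_sum F ?T n"
    using T4 by (intro finitely_positiveD[OF pos]) (auto simp: tight_def n_def)
  ultimately show False by simp
qed

text \<open>
A walk from \<open>c\<close> that never turns back and stops only at a dead end. The index set \<open>I\<close> is an
initial segment of the natural numbers, which covers finite and infinite walks alike.
\<close>

definition ray :: "'v \<Rightarrow> (nat \<Rightarrow> 'v) \<Rightarrow> nat set \<Rightarrow> bool" where
  "ray c s I \<longleftrightarrow> s 0 = c \<and> 0 \<in> I \<and>
    (\<forall>k. Suc k \<in> I \<longrightarrow> k \<in> I \<and> adj (s k) (s (Suc k))) \<and>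
    (\<forall>k. Suc (Suc k) \<in> I \<longrightarrow> s (Suc (Suc k)) \<noteq> s k) \<and>
    (\<forall>k w. Suc k \<in> I \<longrightarrow> Suc (Suc k) \<notin> I \<longrightarrow> adj (s (Suc k)) w \<longrightarrow> w = s k)"

lemma ray_trivial: "ray c (\<lambda>_. c) {0}"
  by (simp add: ray_def)

lemma ray_exists:
  assumes "adj c d"
  obtains s I where "ray c s I" "Suc 0 \<in> I" "s (Suc 0) = d"
proof -
  \<comment> \<open>The state of the walk is the pair of the current and the next vertex.\<close>
  define step where "step p = (snd p, SOME w. adj (snd p) w \<and> w \<noteq> fst p)" for p
  define s where "s k = fst ((step ^^ k) (c, d))" for k
  define ext where "ext k \<longleftrightarrow> (\<exists>w. adj (s (Suc k)) w \<and> w \<noteq> s k)" for k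
  define I where "I = {k. \<forall>j. Suc j < k \<longrightarrow> ext j}"
  have snd_s: "snd ((step ^^ k) (c, d)) = s (Suc k)" for k
    by (simp add: s_def step_def)
  have s_step: "s (Suc (Suc k)) = (SOME w. adj (s (Suc k)) w \<and> w \<noteq> s k)" for k
  proof -
    have "s (Suc (Suc k)) = snd (step ((step ^^ k) (c, d)))"
      by (simp add: s_def step_def)
    also have "\<dots> = (SOME w. adj (snd ((step ^^ k) (c, d))) w \<and> w \<noteq> fst ((step ^^ k) (c, d)))"
      by (simp only: step_def snd_conv)
    finally show ?thesis by (simp only: snd_s s_def[symmetric])
  qed
  have ext: "adj (s (Suc k)) (s (Suc (Suc k))) \<and> s (Suc (Suc k)) \<noteq> s k" if "ext k" for k
    unfolding s_step using that unfolding ext_def by (rule someI_ex)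
  have s01: "s 0 = c" "s (Suc 0) = d"
    by (simp_all add: s_def step_def)
  have "ray c s I"
    unfolding ray_def
  proof (intro conjI allI impI)
    show "adj (s k) (s (Suc k))" if "Suc k \<in> I" for k
    proof (cases k)
      case 0
      then show ?thesis using s01 assms by simp
    next
      case (Suc j)
      then have "ext j" using that by (simp add: I_def)
      then show ?thesis using ext Suc by blast
    qed
    show "s (Suc (Suc k)) \<noteq> s k" if "Suc (Suc k) \<in> I" for k
      using that ext by (simp add: I_def)
    show "w = s k" if "Suc k \<in> I" "Suc (Suc k) \<notin> I" "adj (s (Suc k)) w" for k w
    proof -
      have "\<not> ext k" using that(1,2) by (auto simp: I_def less_Suc_eq)
      then show ?thesis using that(3) by (auto simp: ext_def)
    qed
  qed (use s01 in \<open>auto simp: I_def\<close>)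
  moreover have "Suc 0 \<in> I" by (simp add: I_def)
  ultimately show thesis using that s01 by blast
qed

end

section \<open>Three rays around a vertex\<close>

text \<open>
The graph seen from a vertex \<open>c\<close>: three rays leave through all its
neighbours, ordered by decreasing length; a ray may consist of \<open>c\<close> only. Either \<open>c\<close> branches or no vertex does.
\<close>

locale star_arms = positive_graph C F
  for C :: "'v set" and F :: "'v rel" +
  fixes c :: 'v and s :: "nat \<Rightarrow> nat \<Rightarrow> 'v" and I :: "nat \<Rightarrow> nat set"
  assumes c: "c \<in> C"
    and ray: "\<And>i. i < 3 \<Longrightarrow> ray c (s i) (I i)"
    and firsts: "\<And>i j. i < 3 \<Longrightarrow> j < 3 \<Longrightarrow> i \<noteq> j \<Longrightarrow> Suc 0 \<in> I i \<Longrightarrow> Suc 0 \<in> I j \<Longrightarrow>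
      s i (Suc 0) \<noteq> s j (Suc 0)"
    and nbrs: "\<And>w. adj c w \<Longrightarrow> \<exists>i<3. Suc 0 \<in> I i \<and> w = s i (Suc 0)"
    and branch: "(\<forall>i<3. Suc 0 \<in> I i) \<or>
      (\<forall>v x y z. adj v x \<and> adj v y \<and> adj v z \<longrightarrow> x = y \<or> x = z \<or> y = z)"
    and sorted: "I 2 \<subseteq> I 1" "I 1 \<subseteq> I 0"
begin

lemma s_0 [simp]: "i < 3 \<Longrightarrow> s i 0 = c" and I_0 [simp]: "i < 3 \<Longrightarrow> 0 \<in> I i"
  and I_Suc: "i < 3 \<Longrightarrow> Suc k \<in> I i \<Longrightarrow> k \<in> I i"
  and adj_s: "i < 3 \<Longrightarrow> Suc k \<in> I i \<Longrightarrow> adj (s i k) (s i (Suc k))"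
  and no_turn: "i < 3 \<Longrightarrow> Suc (Suc k) \<in> I i \<Longrightarrow> s i (Suc (Suc k)) \<noteq> s i k"
  and ray_end: "i < 3 \<Longrightarrow> Suc k \<in> I i \<Longrightarrow> Suc (Suc k) \<notin> I i \<Longrightarrow> adj (s i (Suc k)) w \<Longrightarrow> w = s i k"
  using ray[of i] unfolding ray_def by simp_all

lemma I_downward: "i < 3 \<Longrightarrow> k \<in> I i \<Longrightarrow> j \<le> k \<Longrightarrow> j \<in> I i"
  by (induction k) (auto simp: le_Suc_eq dest: I_Suc)

lemma s_in_C: "i < 3 \<Longrightarrow> k \<in> I i \<Longrightarrow> s i k \<in> C"
  using adj_C(2)[OF adj_s] c by (cases k) auto

definition truncated :: "(nat \<Rightarrow> nat) \<Rightarrow> 'v set" where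
  "truncated p = (\<Union>i<3. s i ` {..p i})"

text \<open>
The truncated star is a tree, its vertices are distinct and its only edges are the
steps of the rays; so the form is known explicitly. All four are carried through one induction,
because the next vertex of a ray is new exactly for the reason that the known edges leave no way
back.
\<close>

definition chart :: "(nat \<Rightarrow> nat) \<Rightarrow> bool" where
  "chart p \<longleftrightarrow> (\<forall>i<3. p i \<in> I i) \<and> tight (truncated p) \<and>
    (\<forall>i<3. \<forall>j<3. \<forall>k\<le>p i. \<forall>l\<le>p j. s i k = s j l \<longrightarrow> k = 0 \<and> l = 0 \<or> i = j \<and> k = l) \<and>
    (\<forall>x\<in>truncated p. \<forall>y\<in>truncated p. adj x y \<longrightarrow>
      (\<exists>i<3. \<exists>k<p i. x = s i k \<and> y = s i (Suc k) \<or> x = s i (Suc k) \<and> y = s i k)) \<and>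
    (\<forall>n. tits_sum F (truncated p) n =
      (n c)\<^sup>2 + (\<Sum>i<3. \<Sum>k<p i. (n (s i (Suc k)))\<^sup>2 - n (s i k) * n (s i (Suc k))))"

lemma chart_start: "chart (\<lambda>_. 0)"
proof -
  have b: "truncated (\<lambda>_. 0) = {c}" using s_0 by (auto simp: truncated_def numeral_3_eq_3 lessThan_Suc)
  have "arcs_in F {c} = {}" using no_loop by blast
  then have "tits_sum F {c} n = (n c)\<^sup>2" for n by (simp add: tits_sum_def)
  then show ?thesis
    unfolding chart_def b using tight_singleton[OF c] adj_irrefl by simp
qed

lemma chart_extend:
  assumes p: "chart p" and i: "i < 3" "Suc (p i) \<in> I i"
  shows "chart (p(i := Suc (p i)))"
proof -
  let ?q = "p(i := Suc (p i))" and ?u = "s i (p i)" and ?v = "s i (Suc (p i))"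
  have valid: "\<And>j. j < 3 \<Longrightarrow> p j \<in> I j"
    and tight: "tight (truncated p)"
    and inj: "\<And>i j k l. i < 3 \<Longrightarrow> j < 3 \<Longrightarrow> k \<le> p i \<Longrightarrow> l \<le> p j \<Longrightarrow> s i k = s j l \<Longrightarrow>
      k = 0 \<and> l = 0 \<or> i = j \<and> k = l"
    and edges: "\<And>x y. x \<in> truncated p \<Longrightarrow> y \<in> truncated p \<Longrightarrow> adj x y \<Longrightarrow>
      \<exists>i<3. \<exists>k<p i. x = s i k \<and> y = s i (Suc k) \<or> x = s i (Suc k) \<and> y = s i k"
    and form: "\<And>n. tits_sum F (truncated p) n =
      (n c)\<^sup>2 + (\<Sum>i<3. \<Sum>k<p i. (n (s i (Suc k)))\<^sup>2 - n (s i k) * n (s i (Suc k)))"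
    using p unfolding chart_def by blast+
  have u: "?u \<in> truncated p" using i by (auto simp: truncated_def)
  have adj: "adj ?u ?v" using adj_s i by blast
  have truncated_q: "truncated ?q = insert ?v (truncated p)"
  proof -
    have "truncated ?q = (\<Union>j<3. s j ` {..p j} \<union> (if j = i then {?v} else {}))"
      unfolding truncated_def by (intro SUP_cong) (auto simp: atMost_Suc)
    also have "\<dots> = insert ?v (truncated p)" using i by (auto simp: truncated_def split: if_splits)
    finally show ?thesis .
  qed
  have v: "?v \<notin> truncated p"
  proof
    assume "?v \<in> truncated p"
    then obtain j k where jk: "j < 3" "k < p j"
      "?u = s j k \<and> ?v = s j (Suc k) \<or> ?u = s j (Suc k) \<and> ?v = s j k"
      using edges[OF u _ adj] by blast
    from jk(3) show False
    proof (elim disjE conjE)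
      assume eq: "?u = s j k" "?v = s j (Suc k)"
      have "p i = 0 \<and> k = 0 \<or> i = j \<and> p i = k"
        using jk(1,2) i(1) eq(1) by (intro inj) auto
      then have "p i = 0" "k = 0" "i \<noteq> j" using jk(2) by auto
      moreover from this have "Suc 0 \<in> I j"
        using I_downward[of j "p j" "Suc 0"] valid jk(1,2) by simp
      ultimately show False
        using firsts[of i j] i jk(1) eq(2) by simp
    next
      assume eq: "?u = s j (Suc k)" "?v = s j k"
      have "p i = 0 \<and> Suc k = 0 \<or> i = j \<and> p i = Suc k"
        using jk(1,2) i(1) eq(1) by (intro inj) auto
      then have "i = j" "p i = Suc k" by auto
      then show False using no_turn[of i k] i eq(2) by simp
    qed
  qed
  show ?thesis
    unfolding chart_def
  proof (intro conjI allI impI ballI)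
    show "?q j \<in> I j" if "j < 3" for j using valid i that by simp
  next
    show "tight (truncated ?q)" unfolding truncated_q using tight u v adj by (rule tight_insert)
  next
    fix a b k l assume *: "a < 3" "b < 3" "k \<le> ?q a" "l \<le> ?q b" "s a k = s b l"
    have in_truncated: "s a k \<in> truncated p" if "a < 3" "k \<le> p a" for a k
      using that by (auto simp: truncated_def)
    show "k = 0 \<and> l = 0 \<or> a = b \<and> k = l"
    proof (cases "a = i \<and> k = Suc (p i)"; cases "b = i \<and> l = Suc (p i)")
      assume 1: "a = i \<and> k = Suc (p i)" "\<not> (b = i \<and> l = Suc (p i))"
      then have "l \<le> p b" using * by (auto split: if_splits)
      then show ?thesis using 1 v * in_truncated[of b l] by simp
    next
      assume 1: "\<not> (a = i \<and> k = Suc (p i))" "b = i \<and> l = Suc (p i)"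
      then have "k \<le> p a" using * by (auto split: if_splits)
      then show ?thesis using 1 v * in_truncated[of a k] by simp
    next
      assume 1: "\<not> (a = i \<and> k = Suc (p i))" "\<not> (b = i \<and> l = Suc (p i))"
      then have "k \<le> p a" "l \<le> p b" using * by (auto split: if_splits)
      then show ?thesis using * by (intro inj)
    qed simp
  next
    fix x y assume xy: "x \<in> truncated ?q" "y \<in> truncated ?q" "adj x y"
    from tight_adj_insert[OF tight u v adj, of x y]
    have "x \<in> truncated p \<and> y \<in> truncated p \<or> x = ?u \<and> y = ?v \<or> x = ?v \<and> y = ?u"
      using xy by (simp add: truncated_q)
    then show "\<exists>j<3. \<exists>k<?q j. x = s j k \<and> y = s j (Suc k) \<or> x = s j (Suc k) \<and> y = s j k"
    proof (elim disjE conjE)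
      assume "x \<in> truncated p" "y \<in> truncated p"
      then obtain j k where "j < 3" "k < p j" "x = s j k \<and> y = s j (Suc k) \<or> x = s j (Suc k) \<and> y = s j k"
        using edges xy by blast
      then show ?thesis by (intro exI[of _ j] conjI exI[of _ k]) auto
    next
      assume "x = ?u" "y = ?v"
      then show ?thesis using i by (intro exI[of _ i] conjI exI[of _ "p i"]) auto
    next
      assume "x = ?v" "y = ?u"
      then show ?thesis using i by (intro exI[of _ i] conjI exI[of _ "p i"]) auto
    qed
  next
    fix n :: "'v \<Rightarrow> int"
    let ?t = "\<lambda>j k. (n (s j (Suc k)))\<^sup>2 - n (s j k) * n (s j (Suc k))"
    have "(\<Sum>j<3. \<Sum>k<?q j. ?t j k) = (\<Sum>j<3. (\<Sum>k<p j. ?t j k) + (if j = i then ?t i (p i) else 0))"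
      by (intro sum.cong) auto
    also have "\<dots> = (\<Sum>j<3. \<Sum>k<p j. ?t j k) + ?t i (p i)"
      using i by (simp add: sum.distrib)
    finally show "tits_sum F (truncated ?q) n = (n c)\<^sup>2 + (\<Sum>j<3. \<Sum>k<?q j. ?t j k)"
      unfolding truncated_q tits_sum_tight_insert[OF tight u v adj] form by simp
  qed
qed

lemma chart_all:
  assumes "\<And>i. i < 3 \<Longrightarrow> p i \<in> I i" "\<And>i. \<not> i < 3 \<Longrightarrow> p i = 0"
  shows "chart p"
  using assms
proof (induction "\<Sum>i<3. p i" arbitrary: p)
  case 0
  then have "p = (\<lambda>_. 0)" by (intro ext) (metis finite_lessThan lessThan_iff sum_eq_0_iff)
  then show ?case using chart_start by simp
next
  case (Suc m)
  then obtain i where i: "i < 3" "p i \<noteq> 0"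
    by (metis (mono_tags, lifting) lessThan_iff nat.distinct(1) sum.neutral)
  define q where "q = p(i := p i - 1)"
  have pq: "p = q(i := Suc (q i))" using i by (auto simp: q_def)
  have "(\<Sum>j<3. p j) = (\<Sum>j<3. q j + (if j = i then 1 else 0))"
    using i by (intro sum.cong) (auto simp: q_def)
  also have "\<dots> = (\<Sum>j<3. q j) + 1" using i by (simp add: sum.distrib)
  finally have "m = (\<Sum>j<3. q j)" using Suc.hyps(2) by simp
  moreover have "q j \<in> I j" if "j < 3" for j
    using Suc.prems(1)[OF that] I_downward[OF that] by (auto simp: q_def)
  moreover have "q j = 0" if "\<not> j < 3" for j
    using Suc.prems(2)[OF that] i that by (auto simp: q_def)
  ultimately have "chart q" by (rule Suc.hyps(1))
  moreover have "Suc (q i) \<in> I i" using Suc.prems(1)[OF i(1)] i(2) by (simp add: q_def)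
  ultimately show ?case unfolding pq using i(1) by (intro chart_extend)
qed

lemma max_in_I: "k \<in> I i \<Longrightarrow> l \<in> I i \<Longrightarrow> max k l \<in> I i"
  by (simp add: max_def)

lemma common_chart:
  assumes "i < 3" "j < 3" "k \<in> I i" "l \<in> I j"
  obtains p where "chart p" "k \<le> p i" "l \<le> p j"
proof -
  define p where "p m = (if m = i then if i = j then max k l else k else if m = j then l else 0)" for m
  have "chart p"
    using assms by (intro chart_all) (auto simp: p_def max_in_I)
  then show thesis using that by (auto simp: p_def)
qed

lemma s_eq_iff:
  assumes "i < 3" "j < 3" "k \<in> I i" "l \<in> I j"
  shows "s i k = s j l \<longleftrightarrow> k = 0 \<and> l = 0 \<or> i = j \<and> k = l"
proof
  obtain p where "chart p" "k \<le> p i" "l \<le> p j" using assms by (rule common_chart)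
  then show "s i k = s j l \<Longrightarrow> k = 0 \<and> l = 0 \<or> i = j \<and> k = l"
    using assms unfolding chart_def by blast
qed (use assms in auto)

lemma adj_cases:
  assumes "i < 3" "j < 3" "k \<in> I i" "l \<in> I j" "adj (s i k) (s j l)"
  obtains m r where "m < 3" "Suc r \<in> I m"
    "s i k = s m r \<and> s j l = s m (Suc r) \<or> s i k = s m (Suc r) \<and> s j l = s m r"
proof -
  obtain p where p: "chart p" "k \<le> p i" "l \<le> p j" using assms(1-4) by (rule common_chart)
  then have "s i k \<in> truncated p" "s j l \<in> truncated p" using assms by (auto simp: truncated_def)
  then obtain m r where m: "m < 3" "r < p m"
    "s i k = s m r \<and> s j l = s m (Suc r) \<or> s i k = s m (Suc r) \<and> s j l = s m r"
    using p(1) assms(5) unfolding chart_def by blast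
  have "p m \<in> I m" using p(1) m(1) by (simp add: chart_def)
  then have "Suc r \<in> I m" using I_downward[OF m(1)] m(2) by simp
  with m that show thesis by blast
qed

text \<open>
A neighbour \<open>w\<close> of a ray vertex off the rays would make that vertex branch. If \<open>c\<close> branches as well,
the segment between both carries four leaves: the other two neighbours of \<open>c\<close>, \<open>w\<close>, and the
next vertex of the ray.
\<close>

lemma adj_closed:
  assumes i: "i < 3" "k \<in> I i" and w: "adj (s i k) w"
  shows "w \<in> (\<Union>j<3. s j ` I j)"
proof (rule ccontr)
  assume not: "w \<notin> (\<Union>j<3. s j ` I j)"
  have not': "w \<noteq> s j l" if "j < 3" "l \<in> I j" for j l using not that by blast
  have "k \<noteq> 0"
    using nbrs w not' i by (metis s_0)
  then obtain r where r: "k = Suc r" by (cases k) auto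
  have rI: "r \<in> I i" using I_Suc i r by blast
  have w1: "w \<noteq> s i r" using not' i rI by blast
  then have sI: "Suc (Suc r) \<in> I i" using ray_end i w r by blast
  have w2: "w \<noteq> s i (Suc (Suc r))" using not' i sI by blast
  have backw: "adj (s i k) (s i r)" using adj_s[of i r] i r adj_sym by blast
  have forw: "adj (s i k) (s i (Suc (Suc r)))" using adj_s i(1) sI r by blast
  have turn: "s i (Suc (Suc r)) \<noteq> s i r" using no_turn i(1) sI by blast
  from branch show False
  proof
    assume "\<forall>v x y z. adj v x \<and> adj v y \<and> adj v z \<longrightarrow> x = y \<or> x = z \<or> y = z"
    then show False using backw forw turn w w1 w2 by blast
  next
    assume three: "\<forall>j<3. Suc 0 \<in> I j"
    obtain a b where ab: "a < 3" "b < 3" "a \<noteq> b" "a \<noteq> i" "b \<noteq> i"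
    proof -
      have "i = 0 \<or> i = 1 \<or> i = 2" using i by auto
      then show thesis using that[of 1 2] that[of 0 2] that[of 0 1] by auto
    qed
    \<comment> \<open>Truncated to the segment from c to the vertex at position k of ray i.\<close>
    define p where "p j = (if j = i then k else 0)" for j
    have "chart p" using i by (intro chart_all) (auto simp: p_def)
    then have tight: "tight (truncated p)" by (simp add: chart_def)
    have truncated_p: "x \<in> truncated p \<longleftrightarrow> (\<exists>l\<le>k. x = s i l)" for x
      using i by (auto simp: truncated_def p_def)
    have lI: "l \<in> I i" if "l \<le> k" for l using I_downward i that by blast
    show False
    proof (rule no_four_leaves[OF tight, of "s a 1" "s b 1" "s i (Suc (Suc r))" w c c "s i k" "s i k"])
      show "s a 1 \<notin> truncated p" "s b 1 \<notin> truncated p"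
        unfolding truncated_p using three ab i lI by (auto simp: s_eq_iff)
      show "s i (Suc (Suc r)) \<notin> truncated p"
        unfolding truncated_p using sI i lI r by (auto simp: s_eq_iff)
      show "w \<notin> truncated p"
        unfolding truncated_p using not' i lI by auto
      show "distinct [s a 1, s b 1, s i (Suc (Suc r)), w]"
        using three ab i sI not'[of a 1] not'[of b 1] w2 by (auto simp: s_eq_iff)
      show "c \<in> truncated p" "c \<in> truncated p" unfolding truncated_p using i s_0 by (metis le0)+
      show "s i k \<in> truncated p" "s i k \<in> truncated p" unfolding truncated_p by blast+
      show "adj c (s a 1)" "adj c (s b 1)" using adj_s[of a 0] adj_s[of b 0] three ab by simp_all
      show "adj (s i k) (s i (Suc (Suc r)))" by (rule forw)
      show "adj (s i k) w" by (rule w)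
    qed
  qed
qed

lemma C_eq: "C = (\<Union>j<3. s j ` I j)"
proof
  show "(\<Union>j<3. s j ` I j) \<subseteq> C" using s_in_C by auto
  show "C \<subseteq> (\<Union>j<3. s j ` I j)"
  proof
    fix v assume "v \<in> C"
    then have "(c, v) \<in> linked F" using linkC c by blast
    then show "v \<in> (\<Union>j<3. s j ` I j)"
    proof (rule linked_in_closed(2))
      show "c \<in> (\<Union>j<3. s j ` I j)" by (auto intro!: bexI[of _ 0] image_eqI[of _ _ 0])
      fix x y assume "(x, y) \<in> F"
      then have "adj x y" "adj y x" by (auto simp: adj_def)
      then show "x \<in> (\<Union>j<3. s j ` I j) \<longleftrightarrow> y \<in> (\<Union>j<3. s j ` I j)"
        using adj_closed by blast
    qed
  qed
qed

text \<open>
The form of a weight \<open>x i k\<close> at position \<open>k\<close> of ray \<open>i\<close>. Null vectors of extended diagrams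
contradict it.
\<close>

lemma weight_positive:
  fixes x :: "nat \<Rightarrow> nat \<Rightarrow> int"
  assumes p: "\<And>i. i < 3 \<Longrightarrow> p i \<in> I i" and x: "\<And>i. i < 3 \<Longrightarrow> x i 0 = x0" "x0 \<noteq> 0"
  shows "0 < x0\<^sup>2 + (\<Sum>i<3. \<Sum>k<p i. (x i (Suc k))\<^sup>2 - x i k * x i (Suc k))"
proof -
  define q where "q i = (if i < 3 then p i else 0)" for i
  have chart: "chart q" using p by (intro chart_all) (auto simp: q_def)
  define label where "label v = (SOME a. fst a < 3 \<and> snd a \<in> I (fst a) \<and> v = s (fst a) (snd a))" for v
  define n where "n v = x (fst (label v)) (snd (label v))" for v
  have n: "n (s i k) = x i k" if ik: "i < 3" "k \<in> I i" for i k
  proof -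
    have "fst (label (s i k)) < 3 \<and> snd (label (s i k)) \<in> I (fst (label (s i k))) \<and>
      s i k = s (fst (label (s i k))) (snd (label (s i k)))"
      unfolding label_def by (rule someI[of _ "(i, k)"]) (use ik in simp)
    then have "k = 0 \<and> snd (label (s i k)) = 0 \<and> fst (label (s i k)) < 3 \<or>
      i = fst (label (s i k)) \<and> k = snd (label (s i k))"
      using s_eq_iff ik by blast
    then show ?thesis using x(1) ik by (auto simp: n_def)
  qed
  have nc: "n c = x0" using n[of 0 0] x(1)[of 0] by simp
  have "c \<in> truncated q" using s_0[of 0] by (auto simp: truncated_def intro!: bexI[of _ 0] image_eqI[of _ _ 0])
  then have "0 < tits_sum F (truncated q) n"
    using chart nc x(2) by (intro finitely_positiveD[OF pos]) (auto simp: chart_def tight_def)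
  also have "tits_sum F (truncated q) n =
    (n c)\<^sup>2 + (\<Sum>i<3. \<Sum>k<q i. (n (s i (Suc k)))\<^sup>2 - n (s i k) * n (s i (Suc k)))"
    using chart unfolding chart_def by blast
  also have "(\<Sum>i<3. \<Sum>k<q i. (n (s i (Suc k)))\<^sup>2 - n (s i k) * n (s i (Suc k))) =
    (\<Sum>i<3. \<Sum>k<p i. (x i (Suc k))\<^sup>2 - x i k * x i (Suc k))"
  proof (intro sum.cong refl)
    fix i assume "i \<in> {..<3 :: nat}"
    then show "{..<q i} = {..<p i}" by (simp add: q_def)
  next
    fix i k assume ik: "i \<in> {..<3 :: nat}" "k \<in> {..<p i}"
    then have "k \<in> I i" "Suc k \<in> I i" using I_downward[of i "p i"] p[of i] by simp_all
    then show "(n (s i (Suc k)))\<^sup>2 - n (s i k) * n (s i (Suc k)) = (x i (Suc k))\<^sup>2 - x i k * x i (Suc k)"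
      using n ik by simp
  qed
  finally show ?thesis by (simp add: nc)
qed

end

section \<open>From the lengths of the rays to the diagram\<close>

lemma less_3_iff: "i < 3 \<longleftrightarrow> i = 0 \<or> i = 1 \<or> i = (2 :: nat)"
  by auto

context star_arms
begin

lemma ex_arm: "i < 3 \<Longrightarrow> k \<in> I i \<Longrightarrow> x = \<theta> i k \<Longrightarrow> \<exists>i<3. \<exists>k\<in>I i. x = \<theta> i k"
  by blast

lemma ex_arm_edge:
  "i < 3 \<Longrightarrow> Suc k \<in> I i \<Longrightarrow> x = \<theta> i k \<and> y = \<theta> i (Suc k) \<or> x = \<theta> i (Suc k) \<and> y = \<theta> i k \<Longrightarrow>
    \<exists>i<3. \<exists>k. Suc k \<in> I i \<and> (x = \<theta> i k \<and> y = \<theta> i (Suc k) \<or> x = \<theta> i (Suc k) \<and> y = \<theta> i k)"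
  by blast

text \<open>
It is easiest to describe an isomorphism by the number \<open>\<theta> i k\<close> that it gives to position \<open>k\<close> of
ray \<open>i\<close>; the graph isomorphism itself is the inverse of this numbering.
\<close>

lemma has_underlying_graphI:
  fixes \<theta> :: "nat \<Rightarrow> nat \<Rightarrow> 'b"
  assumes into: "\<And>i k. i < 3 \<Longrightarrow> k \<in> I i \<Longrightarrow> \<theta> i k \<in> X"
    and onto: "\<And>x. x \<in> X \<Longrightarrow> \<exists>i<3. \<exists>k\<in>I i. x = \<theta> i k"
    and zero: "\<And>i. i < 3 \<Longrightarrow> \<theta> i 0 = \<theta> 0 0"
    and inj: "\<And>i j k l. i < 3 \<Longrightarrow> j < 3 \<Longrightarrow> k \<in> I i \<Longrightarrow> l \<in> I j \<Longrightarrow> \<theta> i k = \<theta> j l \<Longrightarrow>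
      k = 0 \<and> l = 0 \<or> i = j \<and> k = l"
    and edge: "\<And>i k. i < 3 \<Longrightarrow> Suc k \<in> I i \<Longrightarrow> (\<theta> i k, \<theta> i (Suc k)) \<in> P \<or> (\<theta> i (Suc k), \<theta> i k) \<in> P"
    and edge': "\<And>x y. (x, y) \<in> P \<Longrightarrow> \<exists>i<3. \<exists>k. Suc k \<in> I i \<and>
      (x = \<theta> i k \<and> y = \<theta> i (Suc k) \<or> x = \<theta> i (Suc k) \<and> y = \<theta> i k)"
  shows "has_underlying_graph (graph_on C F) (X, undirected P)"
proof -
  define label where "label x = (SOME a. fst a < 3 \<and> snd a \<in> I (fst a) \<and> x = \<theta> (fst a) (snd a))" for x
  define \<phi> where "\<phi> x = s (fst (label x)) (snd (label x))" for x
  have \<phi>: "\<phi> (\<theta> i k) = s i k" if ik: "i < 3" "k \<in> I i" for i k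
  proof -
    let ?a = "label (\<theta> i k)"
    have a: "fst ?a < 3 \<and> snd ?a \<in> I (fst ?a) \<and> \<theta> i k = \<theta> (fst ?a) (snd ?a)"
      unfolding label_def by (rule someI[of _ "(i, k)"]) (use ik in simp)
    then have "k = 0 \<and> snd ?a = 0 \<or> i = fst ?a \<and> k = snd ?a"
      using inj[of i "fst ?a" k "snd ?a"] ik by blast
    then show ?thesis using a ik by (auto simp: \<phi>_def)
  qed
  have "bij_betw \<phi> X C"
  proof (rule bij_betw_imageI)
    show "inj_on \<phi> X"
    proof (rule inj_onI)
      fix x y assume xy: "x \<in> X" "y \<in> X" "\<phi> x = \<phi> y"
      obtain i k where ik: "i < 3" "k \<in> I i" "x = \<theta> i k" using onto[OF xy(1)] by blast
      obtain j l where jl: "j < 3" "l \<in> I j" "y = \<theta> j l" using onto[OF xy(2)] by blast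
      have "s i k = s j l" using xy(3) ik jl \<phi> by simp
      then have "k = 0 \<and> l = 0 \<or> i = j \<and> k = l" using s_eq_iff ik jl by blast
      then show "x = y" using ik jl zero by metis
    qed
    show "\<phi> ` X = C"
    proof
      show "\<phi> ` X \<subseteq> C" using onto \<phi> s_in_C by fastforce
      show "C \<subseteq> \<phi> ` X"
      proof
        fix v assume "v \<in> C"
        then obtain i k where "i < 3" "k \<in> I i" "v = s i k" unfolding C_eq by blast
        then show "v \<in> \<phi> ` X" using into \<phi> by (intro image_eqI[of _ _ "\<theta> i k"]) auto
      qed
    qed
  qed
  moreover have "bij_betw (\<lambda>a. {fst a, snd a}) F ((\<lambda>e. \<phi> ` e) ` undirected P)"
  proof (rule bij_betw_imageI)
    show "inj_on (\<lambda>a. {fst a, snd a}) F"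
    proof (rule inj_onI)
      fix a b assume "a \<in> F" "b \<in> F" "{fst a, snd a} = {fst b, snd b}"
      then show "a = b"
        using no_opposite[of "fst a" "snd a"] by (cases a; cases b) (auto simp: doubleton_eq_iff)
    qed
    show "(\<lambda>a. {fst a, snd a}) ` F = (\<lambda>e. \<phi> ` e) ` undirected P"
    proof (intro equalityI subsetI)
      fix e assume "e \<in> (\<lambda>a. {fst a, snd a}) ` F"
      then obtain u v where uv: "(u, v) \<in> F" "e = {u, v}" by force
      then have adj: "adj u v" by (simp add: adj_def)
      obtain i k where u: "i < 3" "k \<in> I i" "u = s i k" using adj_C[OF adj] unfolding C_eq by blast
      obtain j l where v: "j < 3" "l \<in> I j" "v = s j l" using adj_C[OF adj] unfolding C_eq by blast
      obtain m r where mr: "m < 3" "Suc r \<in> I m"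
        "s i k = s m r \<and> s j l = s m (Suc r) \<or> s i k = s m (Suc r) \<and> s j l = s m r"
        using adj_cases[OF u(1) v(1) u(2) v(2)] adj u(3) v(3) by blast
      have "e = \<phi> ` {\<theta> m r, \<theta> m (Suc r)}"
        using mr u(3) v(3) uv(2) \<phi> I_Suc[OF mr(1,2)] by auto
      moreover have "{\<theta> m r, \<theta> m (Suc r)} \<in> undirected P"
        using edge[OF mr(1,2)] by (force simp: undirected_def)
      ultimately show "e \<in> (\<lambda>e. \<phi> ` e) ` undirected P" by blast
    next
      fix e assume "e \<in> (\<lambda>e. \<phi> ` e) ` undirected P"
      then obtain x y where xy: "(x, y) \<in> P" "e = \<phi> ` {x, y}" by (auto simp: undirected_def)
      obtain i k where ik: "i < 3" "Suc k \<in> I i"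
        "x = \<theta> i k \<and> y = \<theta> i (Suc k) \<or> x = \<theta> i (Suc k) \<and> y = \<theta> i k"
        using edge'[OF xy(1)] by blast
      have "e = {s i k, s i (Suc k)}"
        using ik xy(2) \<phi> I_Suc[OF ik(1,2)] by auto
      moreover have "adj (s i k) (s i (Suc k))" using adj_s ik by blast
      ultimately show "e \<in> (\<lambda>a. {fst a, snd a}) ` F"
        by (force simp: adj_def)
    qed
  qed
  ultimately show ?thesis by (auto simp: has_underlying_graph_def)
qed

lemma I_shape:
  assumes "i < 3"
  shows "I i = UNIV \<or> (\<exists>m. I i = {..m})"
proof (cases "I i = UNIV")
  case False
  then obtain k where k: "k \<notin> I i" "\<And>j. j < k \<Longrightarrow> j \<in> I i"
    using exists_least_iff[of "\<lambda>k. k \<notin> I i"] by blast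
  have "k \<noteq> 0" using k(1) assms I_0 by metis
  moreover have "j < k" if "j \<in> I i" for j
    using I_downward[OF assms that, of k] k(1) by (meson not_less)
  ultimately have "I i = {..k - 1}" using k(2) by fastforce
  then show ?thesis by blast
qed simp

lemma I_bounded_shape:
  assumes "i < 3" "m \<in> I i" "Suc m \<notin> I i"
  shows "I i = {..m}"
  using I_downward[OF assms(1), of _ "Suc m"] I_downward[OF assms(1,2)] assms(3)
  by (auto simp: not_less_eq_eq[symmetric])

lemma dynkin_two_arms:
  assumes I2: "I 2 = {0}"
  shows "dynkin (graph_on C F)"
proof -
  consider (both) "I 0 = UNIV" "I 1 = UNIV" | (one) q where "I 0 = UNIV" "I 1 = {..q}"
    | (none) p q where "I 0 = {..p}" "I 1 = {..q}"
    using I_shape[of 0] I_shape[of 1] sorted(2) by fastforce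
  then show ?thesis
  proof cases
    case both
    have "has_underlying_graph (graph_on C F) (UNIV, undirected line_arcs)"
    proof (rule has_underlying_graphI[where \<theta> = "\<lambda>i k. if i = 0 then int k else - int k"])
      fix x :: int
      show "\<exists>i<3. \<exists>k\<in>I i. x = (if i = 0 then int k else - int k)"
      proof (cases "x \<ge> 0")
        case True
        then show ?thesis using both by (intro ex_arm[of 0 "nat x"] ex_arm_edge[of 0 "nat x"]) auto
      next
        case False
        then show ?thesis using both by (intro ex_arm[of 1 "nat (- x)"] ex_arm_edge[of 1 "nat (- x)"]) auto
      qed
    next
      fix x y :: int assume "(x, y) \<in> line_arcs"
      then have y: "y = x + 1" by (auto simp: line_arcs_def)
      show "\<exists>i<3. \<exists>k. Suc k \<in> I i \<and>
        (x = (if i = 0 then int k else - int k) \<and> y = (if i = 0 then int (Suc k) else - int (Suc k)) \<or>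
         x = (if i = 0 then int (Suc k) else - int (Suc k)) \<and> y = (if i = 0 then int k else - int k))"
      proof (cases "x \<ge> 0")
        case True
        then show ?thesis using both y by (intro ex_arm[of 0 "nat x"] ex_arm_edge[of 0 "nat x"]) auto
      next
        case False
        then show ?thesis using both y by (intro ex_arm[of 1 "nat (- y)"] ex_arm_edge[of 1 "nat (- y)"]) auto
      qed
    qed (use both I2 in \<open>auto simp: less_3_iff line_arcs_def split: if_splits\<close>)
    then show ?thesis unfolding dynkin_def A_inf_inf_graph_undirected by blast
  next
    case one
    let ?\<theta> = "\<lambda>i k. if i = 0 then q + k else q - k"
    have "has_underlying_graph (graph_on C F) (UNIV, undirected {(i :: nat, i + 1) | i. True})"
    proof (rule has_underlying_graphI[where \<theta> = ?\<theta>])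
      fix x :: nat
      show "\<exists>i<3. \<exists>k\<in>I i. x = ?\<theta> i k"
      proof (cases "x \<ge> q")
        case True
        then show ?thesis using one by (intro ex_arm[of 0 "x - q"] ex_arm_edge[of 0 "x - q"]) auto
      next
        case False
        then show ?thesis using one by (intro ex_arm[of 1 "q - x"] ex_arm_edge[of 1 "q - x"]) auto
      qed
    next
      fix x y :: nat assume "(x, y) \<in> {(i, i + 1) | i. True}"
      then have y: "y = Suc x" by auto
      show "\<exists>i<3. \<exists>k. Suc k \<in> I i \<and>
        (x = ?\<theta> i k \<and> y = ?\<theta> i (Suc k) \<or> x = ?\<theta> i (Suc k) \<and> y = ?\<theta> i k)"
      proof (cases "x \<ge> q")
        case True
        then show ?thesis using one y by (intro ex_arm[of 0 "x - q"] ex_arm_edge[of 0 "x - q"]) auto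
      next
        case False
        then show ?thesis using one y by (intro ex_arm[of 1 "q - y"] ex_arm_edge[of 1 "q - y"]) auto
      qed
    qed (use one I2 in \<open>auto simp: less_3_iff split: if_splits\<close>)
    then show ?thesis unfolding dynkin_def A_inf_graph_undirected by blast
  next
    case none
    let ?\<theta> = "\<lambda>i k. if i = 0 then q + 1 + k else q + 1 - k"
    let ?n = "p + q + 1"
    have "has_underlying_graph (graph_on C F) ({1..?n}, undirected {(i, i + 1) | i. 1 \<le> i \<and> i < ?n})"
    proof (rule has_underlying_graphI[where \<theta> = ?\<theta>])
      fix x :: nat assume x: "x \<in> {1..?n}"
      show "\<exists>i<3. \<exists>k\<in>I i. x = ?\<theta> i k"
      proof (cases "x > q")
        case True
        then show ?thesis using none x by (intro ex_arm[of 0 "x - (q + 1)"] ex_arm_edge[of 0 "x - (q + 1)"]) auto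
      next
        case False
        then show ?thesis using none x by (intro ex_arm[of 1 "q + 1 - x"] ex_arm_edge[of 1 "q + 1 - x"]) auto
      qed
    next
      fix x y :: nat assume "(x, y) \<in> {(i, i + 1) | i. 1 \<le> i \<and> i < ?n}"
      then have y: "y = Suc x" "1 \<le> x" "x < ?n" by auto
      show "\<exists>i<3. \<exists>k. Suc k \<in> I i \<and>
        (x = ?\<theta> i k \<and> y = ?\<theta> i (Suc k) \<or> x = ?\<theta> i (Suc k) \<and> y = ?\<theta> i k)"
      proof (cases "x > q")
        case True
        then show ?thesis using none y by (intro ex_arm[of 0 "x - (q + 1)"] ex_arm_edge[of 0 "x - (q + 1)"]) auto
      next
        case False
        then show ?thesis using none y by (intro ex_arm[of 1 "q - x"] ex_arm_edge[of 1 "q - x"]) auto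
      qed
    qed (use none I2 in \<open>auto simp: less_3_iff split: if_splits\<close>)
    moreover have "?n \<ge> 1" by simp
    ultimately show ?thesis unfolding dynkin_def A_graph_undirected by blast
  qed
qed

lemma dynkin_two_short_arms:
  assumes I2: "I 2 = {..1}" and I1: "I 1 = {..1}"
  shows "dynkin (graph_on C F)"
proof -
  have I0: "1 \<in> I 0" using sorted(2) I1 by auto
  consider (inf) "I 0 = UNIV" | (fin) p where "I 0 = {..p}"
    using I_shape[of 0] by fastforce
  then show ?thesis
  proof cases
    case inf
    let ?\<theta> = "\<lambda>i k. if i = 0 \<or> k = 0 then k + 2 else if i = 1 then 0 else (1 :: nat)"
    have "has_underlying_graph (graph_on C F) (UNIV, undirected D_arcs)"
    proof (rule has_underlying_graphI[where \<theta> = ?\<theta>])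
      fix x :: nat
      consider "x = 0" | "x = 1" | "x \<ge> 2" by linarith
      then show "\<exists>i<3. \<exists>k\<in>I i. x = ?\<theta> i k"
      proof cases
        case 1
        then show ?thesis using I1 by (intro ex_arm[of 1 1] ex_arm_edge[of 1 1]) auto
      next
        case 2
        then show ?thesis using I2 by (intro ex_arm[of 2 1] ex_arm_edge[of 2 1]) auto
      next
        case 3
        then show ?thesis using inf by (intro ex_arm[of 0 "x - 2"] ex_arm_edge[of 0 "x - 2"]) auto
      qed
    next
      fix x y :: nat assume "(x, y) \<in> D_arcs"
      then consider "x = 0" "y = 2" | "x = 1" "y = 2" | "x \<ge> 2" "y = Suc x"
        by (fastforce simp: D_arcs_def)
      then show "\<exists>i<3. \<exists>k. Suc k \<in> I i \<and>
        (x = ?\<theta> i k \<and> y = ?\<theta> i (Suc k) \<or> x = ?\<theta> i (Suc k) \<and> y = ?\<theta> i k)"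
      proof cases
        case 1
        then show ?thesis using I1 by (intro ex_arm[of 1 0] ex_arm_edge[of 1 0]) auto
      next
        case 2
        then show ?thesis using I2 by (intro ex_arm[of 2 0] ex_arm_edge[of 2 0]) auto
      next
        case 3
        then show ?thesis using inf by (intro ex_arm[of 0 "x - 2"] ex_arm_edge[of 0 "x - 2"]) auto
      qed
    next
      fix i k assume "i < (3 :: nat)" "Suc k \<in> I i"
      show "(?\<theta> i k, ?\<theta> i (Suc k)) \<in> D_arcs \<or> (?\<theta> i (Suc k), ?\<theta> i k) \<in> D_arcs"
      proof -
        consider "i = 0" | "i = 1" "k = 0" | "i = 2" "k = 0"
          using I1 I2 \<open>i < 3\<close> \<open>Suc k \<in> I i\<close> by (fastforce simp: less_3_iff)
        then show ?thesis
        proof cases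
          case 1
          have "(k + 2, Suc k + 2) \<in> D_arcs"
            unfolding D_arcs_def by (rule UnI2, rule CollectI, rule exI[of _ "Suc k"]) simp
          then show ?thesis using 1 by simp
        qed (simp_all add: D_arcs_def)
      qed
    next
      fix i j k l assume "i < (3 :: nat)" "j < (3 :: nat)" "k \<in> I i" "l \<in> I j" "?\<theta> i k = ?\<theta> j l"
      moreover have "k = 0 \<or> i = 0 \<or> i = 1 \<and> k = 1 \<or> i = 2 \<and> k = 1"
        if "i < (3 :: nat)" "k \<in> I i" for i k
        using that I1 I2 by (fastforce simp: less_3_iff)
      ultimately have "k = 0 \<or> i = 0 \<or> i = 1 \<and> k = 1 \<or> i = 2 \<and> k = 1"
        "l = 0 \<or> j = 0 \<or> j = 1 \<and> l = 1 \<or> j = 2 \<and> l = 1"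
        "?\<theta> i k = ?\<theta> j l"
        by blast+
      then show "k = 0 \<and> l = 0 \<or> i = j \<and> k = l"
        by (elim disjE conjE) simp_all
    next
      show "?\<theta> i 0 = ?\<theta> 0 0" for i by simp
    qed simp
    then show ?thesis unfolding dynkin_def D_inf_graph_undirected by blast
  next
    case fin
    have p: "p \<ge> 1" using I0 fin by simp
    let ?\<theta> = "\<lambda>i k. if i = 0 \<or> k = 0 then p + 1 - k else if i = 1 then p + 2 else p + 3"
    let ?n = "p + 3"
    have "has_underlying_graph (graph_on C F)
      ({1..?n}, undirected ({(i, i + 1) | i. 1 \<le> i \<and> i + 1 < ?n} \<union> {(?n - 2, ?n)}))"
    proof (rule has_underlying_graphI[where \<theta> = ?\<theta>])
      fix x :: nat assume x: "x \<in> {1..?n}"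
      then consider "x = p + 2" | "x = p + 3" | "1 \<le> x" "x \<le> p + 1" by fastforce
      then show "\<exists>i<3. \<exists>k\<in>I i. x = ?\<theta> i k"
      proof cases
        case 1
        then show ?thesis using I1 by (intro ex_arm[of 1 1] ex_arm_edge[of 1 1]) auto
      next
        case 2
        then show ?thesis using I2 by (intro ex_arm[of 2 1] ex_arm_edge[of 2 1]) auto
      next
        case 3
        then show ?thesis using fin by (intro ex_arm[of 0 "p + 1 - x"] ex_arm_edge[of 0 "p + 1 - x"]) auto
      qed
    next
      fix x y :: nat
      assume "(x, y) \<in> {(i, i + 1) | i. 1 \<le> i \<and> i + 1 < ?n} \<union> {(?n - 2, ?n)}"
      then consider "x = p + 1" "y = p + 2" | "x = p + 1" "y = p + 3" | "1 \<le> x" "x \<le> p" "y = Suc x"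
        by fastforce
      then show "\<exists>i<3. \<exists>k. Suc k \<in> I i \<and>
        (x = ?\<theta> i k \<and> y = ?\<theta> i (Suc k) \<or> x = ?\<theta> i (Suc k) \<and> y = ?\<theta> i k)"
      proof cases
        case 1
        then show ?thesis using I1 by (intro ex_arm[of 1 0] ex_arm_edge[of 1 0]) auto
      next
        case 2
        then show ?thesis using I2 by (intro ex_arm[of 2 0] ex_arm_edge[of 2 0]) auto
      next
        case 3
        then show ?thesis using fin by (intro ex_arm[of 0 "p - x"] ex_arm_edge[of 0 "p - x"]) auto
      qed
    next
      fix i k assume ik: "i < (3 :: nat)" "Suc k \<in> I i"
      then consider "i = 0" "k < p" | "i = 1" "k = 0" | "i = 2" "k = 0"
        using I1 I2 fin by (fastforce simp: less_3_iff)
      then show "(?\<theta> i k, ?\<theta> i (Suc k)) \<in> {(i, i + 1) | i. 1 \<le> i \<and> i + 1 < ?n} \<union> {(?n - 2, ?n)} \<or>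
        (?\<theta> i (Suc k), ?\<theta> i k) \<in> {(i, i + 1) | i. 1 \<le> i \<and> i + 1 < ?n} \<union> {(?n - 2, ?n)}"
        by cases auto
    next
      fix i j k l assume "i < (3 :: nat)" "j < (3 :: nat)" "k \<in> I i" "l \<in> I j" "?\<theta> i k = ?\<theta> j l"
      moreover have "(i = 0 \<or> k = 0) \<and> k \<le> p \<or> i = 1 \<and> k = 1 \<or> i = 2 \<and> k = 1"
        if "i < (3 :: nat)" "k \<in> I i" for i k
        using that I1 I2 fin by (fastforce simp: less_3_iff)
      ultimately have kl: "(i = 0 \<or> k = 0) \<and> k \<le> p \<or> i = 1 \<and> k = 1 \<or> i = 2 \<and> k = 1"
        "(j = 0 \<or> l = 0) \<and> l \<le> p \<or> j = 1 \<and> l = 1 \<or> j = 2 \<and> l = 1"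
        and eq: "?\<theta> i k = ?\<theta> j l"
        by blast+
      show "k = 0 \<and> l = 0 \<or> i = j \<and> k = l"
      proof (cases "i = 0 \<or> k = 0"; cases "j = 0 \<or> l = 0")
        assume *: "i = 0 \<or> k = 0" "j = 0 \<or> l = 0"
        then have "k \<le> p" "l \<le> p" using kl p by linarith+
        moreover have "p + 1 - k = p + 1 - l" using eq * by simp
        ultimately have "k = l" by linarith
        with * show ?thesis by blast
      next
        assume *: "i = 0 \<or> k = 0" "\<not> (j = 0 \<or> l = 0)"
        then have "?\<theta> j l \<ge> p + 2" "?\<theta> i k \<le> p + 1" by simp_all
        then show ?thesis using eq by linarith
      next
        assume *: "\<not> (i = 0 \<or> k = 0)" "j = 0 \<or> l = 0"
        then have "?\<theta> i k \<ge> p + 2" "?\<theta> j l \<le> p + 1" by simp_all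
        then show ?thesis using eq by linarith
      next
        assume *: "\<not> (i = 0 \<or> k = 0)" "\<not> (j = 0 \<or> l = 0)"
        then have "k = 1" "l = 1" "i = 1 \<or> i = 2" "j = 1 \<or> j = 2" using kl by blast+
        then show ?thesis using eq by auto
      qed
    next
      show "?\<theta> i 0 = ?\<theta> 0 0" for i by simp
    next
      fix i k assume "i < (3 :: nat)" "k \<in> I i"
      then have "k \<le> p \<or> i \<noteq> 0" using fin by auto
      then show "?\<theta> i k \<in> {1..?n}" by auto
    qed
    moreover have "?n \<ge> 4" using p by simp
    ultimately show ?thesis unfolding dynkin_def D_graph_undirected by blast
  qed
qed

lemma dynkin_exceptional:
  assumes I2: "I 2 = {..1}" and I1: "I 1 = {..2}" and I0: "I 0 = {..p}" and p: "p \<in> {2, 3, 4}"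
  shows "dynkin (graph_on C F)"
proof -
  let ?\<theta> = "\<lambda>i k. if i = 0 \<or> k = 0 then 4 + k else if i = 2 then 2 else if k = 1 then 3 else (1 :: nat)"
  have "has_underlying_graph (graph_on C F) ({1..p + 4}, undirected (E_arcs (p + 4)))"
  proof (rule has_underlying_graphI[where \<theta> = ?\<theta>])
    fix x :: nat assume x: "x \<in> {1..p + 4}"
    then consider "x = 1" | "x = 2" | "x = 3" | "4 \<le> x" "x \<le> p + 4" by fastforce
    then show "\<exists>i<3. \<exists>k\<in>I i. x = ?\<theta> i k"
    proof cases
      case 1
      then show ?thesis using I1 by (intro ex_arm[of 1 2] ex_arm_edge[of 1 2]) auto
    next
      case 2
      then show ?thesis using I2 by (intro ex_arm[of 2 1] ex_arm_edge[of 2 1]) auto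
    next
      case 3
      then show ?thesis using I1 by (intro ex_arm[of 1 1] ex_arm_edge[of 1 1]) auto
    next
      case 4
      then show ?thesis using I0 by (intro ex_arm[of 0 "x - 4"] ex_arm_edge[of 0 "x - 4"]) auto
    qed
  next
    fix x y :: nat
    assume "(x, y) \<in> E_arcs (p + 4)"
    then consider "x = 1" "y = 3" | "x = 2" "y = 4" | "x = 3" "y = 4" | "4 \<le> x" "x < p + 4" "y = Suc x"
      by (fastforce simp: E_arcs_def)
    then show "\<exists>i<3. \<exists>k. Suc k \<in> I i \<and>
      (x = ?\<theta> i k \<and> y = ?\<theta> i (Suc k) \<or> x = ?\<theta> i (Suc k) \<and> y = ?\<theta> i k)"
    proof cases
      case 1
      then show ?thesis using I1 by (intro ex_arm[of 1 1] ex_arm_edge[of 1 1]) auto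
    next
      case 2
      then show ?thesis using I2 by (intro ex_arm[of 2 0] ex_arm_edge[of 2 0]) auto
    next
      case 3
      then show ?thesis using I1 by (intro ex_arm[of 1 0] ex_arm_edge[of 1 0]) auto
    next
      case 4
      then show ?thesis using I0 by (intro ex_arm[of 0 "x - 4"] ex_arm_edge[of 0 "x - 4"]) auto
    qed
  next
    fix i k assume ik: "i < (3 :: nat)" "Suc k \<in> I i"
    then consider "i = 0" "k < p" | "i = 1" "k = 0" | "i = 1" "k = 1" | "i = 2" "k = 0"
      using I0 I1 I2 by (fastforce simp: less_3_iff)
    then show "(?\<theta> i k, ?\<theta> i (Suc k)) \<in> E_arcs (p + 4) \<or> (?\<theta> i (Suc k), ?\<theta> i k) \<in> E_arcs (p + 4)"
      by cases (auto simp: E_arcs_def)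
  next
    fix i k assume ik: "i < (3 :: nat)" "k \<in> I i"
    then show "?\<theta> i k \<in> {1..p + 4}"
      using I0 I1 I2 by (auto simp: less_3_iff)
  next
    fix i j k l assume "i < (3 :: nat)" "j < (3 :: nat)" "k \<in> I i" "l \<in> I j" "?\<theta> i k = ?\<theta> j l"
    moreover have "k = 0 \<or> i = 0 \<or> i = 1 \<and> k = 1 \<or> i = 1 \<and> k = 2 \<or> i = 2 \<and> k = 1"
      if "i < (3 :: nat)" "k \<in> I i" for i k
      using that I1 I2 by (fastforce simp: less_3_iff)
    ultimately have "k = 0 \<or> i = 0 \<or> i = 1 \<and> k = 1 \<or> i = 1 \<and> k = 2 \<or> i = 2 \<and> k = 1"
      "l = 0 \<or> j = 0 \<or> j = 1 \<and> l = 1 \<or> j = 1 \<and> l = 2 \<or> j = 2 \<and> l = 1"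
      "?\<theta> i k = ?\<theta> j l"
      by blast+
    then show "k = 0 \<and> l = 0 \<or> i = j \<and> k = l"
      by (elim disjE conjE) simp_all
  qed auto
  then show ?thesis
    unfolding dynkin_def E_graph_undirected using p by fastforce
qed

text \<open>
Ray lengths in decreasing order are \<open>(p, q, 0)\<close> for type \<open>A\<close>, \<open>(p, 1, 1)\<close> for type \<open>D\<close>, and
\<open>(p, 2, 1)\<close> with \<open>2 \<le> p \<le> 4\<close> for type \<open>E\<close>. The minimal triples beyond these are \<open>(2, 2, 2)\<close>,
\<open>(3, 3, 1)\<close> and \<open>(5, 2, 1)\<close>, the extended diagrams of \<open>E\<^sub>6\<close>, \<open>E\<^sub>7\<close> and \<open>E\<^sub>8\<close>.
\<close>

lemma is_dynkin: "dynkin (graph_on C F)"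
proof (cases "1 \<in> I 2")
  case False
  then have "I 2 = {..0}" by (intro I_bounded_shape) simp_all
  then show ?thesis by (intro dynkin_two_arms) auto
next
  case one: True
  have "2 \<notin> I 2"
  proof
    assume "2 \<in> I 2"
    then have "2 \<in> I i" if "i < 3" for i using that sorted by (auto simp: less_3_iff)
    then show False
      \<comment> \<open>Weight 3 at the centre and 2, 1 along each ray.\<close>
      using weight_positive[of "\<lambda>_. 2" "\<lambda>i k. 3 - int k" 3]
      by (simp add: eval_nat_numeral lessThan_Suc)
  qed
  then have I2: "I 2 = {..1}" using one by (intro I_bounded_shape) (simp_all add: eval_nat_numeral)
  show ?thesis
  proof (cases "2 \<in> I 1")
    case False
    moreover have "1 \<in> I 1" using one sorted by blast
    ultimately have "I 1 = {..1}" by (intro I_bounded_shape) (simp_all add: eval_nat_numeral)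
    with I2 show ?thesis by (rule dynkin_two_short_arms)
  next
    case two: True
    \<comment> \<open>Weight 4 at the centre, 2 on the short ray and 3, 2, 1 along the others.\<close>
    let ?x = "\<lambda>i k. if i = (2 :: nat) then 4 - 2 * int k else 4 - int k"
    have "3 \<notin> I 1"
    proof
      assume "3 \<in> I 1"
      then have "(if i = 2 then 1 else 3) \<in> I i" if "i < 3" for i
        using that sorted one by (auto simp: less_3_iff)
      then have "0 < 4\<^sup>2 + (\<Sum>i<3. \<Sum>k<(if i = 2 then 1 else 3). (?x i (Suc k))\<^sup>2 - ?x i k * ?x i (Suc k))"
        by (rule weight_positive) simp_all
      then show False by (simp add: eval_nat_numeral lessThan_Suc)
    qed
    then have I1: "I 1 = {..2}" using two by (intro I_bounded_shape) (simp_all add: eval_nat_numeral)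
    \<comment> \<open>Weight 6 at the centre and 3, then 4, 2, then 5, 4, 3, 2, 1 along the rays.\<close>
    let ?y = "\<lambda>i k. if i = (2 :: nat) then 6 - 3 * int k else if i = 1 then 6 - 2 * int k else 6 - int k"
    have "5 \<notin> I 0"
    proof
      assume "5 \<in> I 0"
      then have "(if i = 2 then 1 else if i = 1 then 2 else 5) \<in> I i" if "i < 3" for i
        using that one two by (auto simp: less_3_iff)
      then have "0 < 6\<^sup>2 + (\<Sum>i<3. \<Sum>k<(if i = 2 then 1 else if i = 1 then 2 else 5).
          (?y i (Suc k))\<^sup>2 - ?y i k * ?y i (Suc k))"
        by (rule weight_positive) simp_all
      then show False by (simp add: eval_nat_numeral lessThan_Suc)
    qed
    then have "I 0 \<noteq> UNIV" by blast
    then obtain p where p: "I 0 = {..p}" using I_shape[of 0] by auto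
    have "2 \<in> I 0" using two sorted by blast
    then have "2 \<le> p" "\<not> 5 \<le> p" using p \<open>5 \<notin> I 0\<close> by simp_all
    then have "p \<in> {2, 3, 4}" by auto
    with I2 I1 p show ?thesis by (rule dynkin_exceptional)
  qed
qed

end

section \<open>The classification\<close>

context positive_graph
begin

definition arms :: "'v \<Rightarrow> (nat \<Rightarrow> nat \<Rightarrow> 'v) \<Rightarrow> (nat \<Rightarrow> nat set) \<Rightarrow> bool" where
  "arms c s I \<longleftrightarrow> (\<forall>i<3. ray c (s i) (I i)) \<and>
    (\<forall>i<3. \<forall>j<3. i \<noteq> j \<longrightarrow> Suc 0 \<in> I i \<longrightarrow> Suc 0 \<in> I j \<longrightarrow> s i (Suc 0) \<noteq> s j (Suc 0)) \<and>
    (\<forall>w. adj c w \<longrightarrow> (\<exists>i<3. Suc 0 \<in> I i \<and> w = s i (Suc 0)))"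

lemma arms_of_neighbours:
  assumes xs: "distinct xs" "set xs = {w. adj c w}" "length xs \<le> 3"
  obtains s I where "arms c s I" "\<And>i. i < length xs \<Longrightarrow> Suc 0 \<in> I i"
proof -
  have "\<exists>t J. ray c t J \<and> (if i < length xs then Suc 0 \<in> J \<and> t (Suc 0) = xs ! i else Suc 0 \<notin> J)" for i
  proof (cases "i < length xs")
    case True
    then have "adj c (xs ! i)" using xs(2) nth_mem by blast
    then obtain t J where "ray c t J" "Suc 0 \<in> J" "t (Suc 0) = xs ! i" by (rule ray_exists)
    then show ?thesis using True by auto
  next
    case False
    then show ?thesis using ray_trivial by (intro exI[of _ "\<lambda>_. c"] exI[of _ "{0}"]) simp
  qed
  then obtain s I where sI: "\<And>i. ray c (s i) (I i)"
    "\<And>i. if i < length xs then Suc 0 \<in> I i \<and> s i (Suc 0) = xs ! i else Suc 0 \<notin> I i"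
    by metis
  have 1: "i < length xs" "s i (Suc 0) = xs ! i" if "Suc 0 \<in> I i" for i
    using sI(2)[of i] that by (auto split: if_splits)
  have 2: "Suc 0 \<in> I i" if "i < length xs" for i
    using sI(2)[of i] that by simp
  have "arms c s I"
    unfolding arms_def
  proof (intro conjI allI impI)
    show "s i (Suc 0) \<noteq> s j (Suc 0)" if "i \<noteq> j" "Suc 0 \<in> I i" "Suc 0 \<in> I j" for i j
      using 1 that xs(1) by (simp add: nth_eq_iff_index_eq)
    show "\<exists>i<3. Suc 0 \<in> I i \<and> w = s i (Suc 0)" if "adj c w" for w
    proof -
      have "w \<in> set xs" using that xs(2) by simp
      then obtain i where "i < length xs" "xs ! i = w" by (auto simp: in_set_conv_nth)
      then show ?thesis using 1(2)[of i] 2[of i] xs(3) by (intro exI[of _ i]) simp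
    qed
  qed (rule sI(1))
  then show thesis using that 2 by blast
qed

lemma ray_downward: "ray c t J \<Longrightarrow> k \<in> J \<Longrightarrow> j \<le> k \<Longrightarrow> j \<in> J"
  by (induction k) (auto simp: le_Suc_eq ray_def)

lemma ray_total:
  assumes "ray c t J" "ray c t' J'"
  shows "J \<subseteq> J' \<or> J' \<subseteq> J"
  using ray_downward[OF assms(1)] ray_downward[OF assms(2)] by (meson nat_le_linear subsetI)

text \<open>
Index sets of rays from \<open>c\<close> are initial segments, hence comparable, so the rays can be
renumbered by decreasing length.
\<close>

lemma dynkin_of_arms:
  assumes c: "c \<in> C" and arms: "arms c s I"
    and branch: "(\<forall>i<3. Suc 0 \<in> I i) \<or>
      (\<forall>v x y z. adj v x \<and> adj v y \<and> adj v z \<longrightarrow> x = y \<or> x = z \<or> y = z)"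
  shows "dynkin (graph_on C F)"
proof -
  have total: "I i \<subseteq> I j \<or> I j \<subseteq> I i" if "i < 3" "j < 3" for i j
    using arms that ray_total[of c "s i" "I i" "s j" "I j"] by (auto simp: arms_def)
  obtain i j k :: nat where ijk: "i < 3" "j < 3" "k < 3" "i \<noteq> j" "i \<noteq> k" "j \<noteq> k" "I k \<subseteq> I j" "I j \<subseteq> I i"
  proof -
    note tot = total[of 0 1, simplified] total[of 0 2, simplified] total[of 1 2, simplified]
    show thesis
      using tot that[of 0 1 2, simplified] that[of 0 2 1, simplified] that[of 1 0 2, simplified]
        that[of 1 2 0, simplified] that[of 2 0 1, simplified] that[of 2 1 0, simplified]
      by blast
  qed
  define \<pi> where "\<pi> m = (if m = 0 then i else if m = 1 then j else k)" for m :: nat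
  have less: "\<pi> m < 3" for m using ijk by (simp add: \<pi>_def)
  have inj: "\<pi> m \<noteq> \<pi> n" if "m < 3" "n < 3" "m \<noteq> n" for m n
    using that ijk by (auto simp: \<pi>_def less_3_iff)
  have surj: "\<exists>m<3. \<pi> m = n" if "n < 3" for n
  proof -
    have "n = i \<or> n = j \<or> n = k" using that ijk by (auto simp: less_3_iff)
    then show ?thesis
      by (elim disjE; intro exI[of _ 0] exI[of _ 1] exI[of _ 2]) (auto simp: \<pi>_def)
  qed
  interpret star_arms C F c "\<lambda>m. s (\<pi> m)" "\<lambda>m. I (\<pi> m)"
  proof
    show "c \<in> C" by (rule c)
    show "ray c (s (\<pi> m)) (I (\<pi> m))" if "m < 3" for m
      using arms less by (simp add: arms_def)
    show "s (\<pi> m) (Suc 0) \<noteq> s (\<pi> n) (Suc 0)"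
      if "m < 3" "n < 3" "m \<noteq> n" "Suc 0 \<in> I (\<pi> m)" "Suc 0 \<in> I (\<pi> n)" for m n
      using arms that less inj by (simp add: arms_def)
    show "\<exists>m<3. Suc 0 \<in> I (\<pi> m) \<and> w = s (\<pi> m) (Suc 0)" if "adj c w" for w
      using arms that surj unfolding arms_def by metis
    show "(\<forall>m<3. Suc 0 \<in> I (\<pi> m)) \<or>
      (\<forall>v x y z. adj v x \<and> adj v y \<and> adj v z \<longrightarrow> x = y \<or> x = z \<or> y = z)"
      using branch less by blast
    show "I (\<pi> 2) \<subseteq> I (\<pi> 1)" "I (\<pi> 1) \<subseteq> I (\<pi> 0)"
      using ijk by (simp_all add: \<pi>_def)
  qed
  show ?thesis by (rule is_dynkin)
qed

lemma positive_is_dynkin: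
  assumes "C \<noteq> {}"
  shows "dynkin (graph_on C F)"
proof (cases "\<exists>c x y z. adj c x \<and> adj c y \<and> adj c z \<and> x \<noteq> y \<and> x \<noteq> z \<and> y \<noteq> z")
  case True
  then obtain c x y z where xyz: "adj c x" "adj c y" "adj c z" "distinct [x, y, z]" by auto
  have c: "c \<in> C" using adj_C xyz by blast
  have "w \<in> {x, y, z}" if "adj c w" for w
  proof (rule ccontr)
    assume "w \<notin> {x, y, z}"
    then show False
      using no_four_leaves[OF tight_singleton[OF c], of x y z w c c c c] xyz that adj_irrefl by auto
  qed
  then have "set [x, y, z] = {w. adj c w}" using xyz by auto
  with xyz(4) obtain s I where "arms c s I" "\<And>i. i < length [x, y, z] \<Longrightarrow> Suc 0 \<in> I i"
    by (rule arms_of_neighbours) simp_all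
  then show ?thesis using c by (intro dynkin_of_arms) auto
next
  case False
  then have two: "x = y \<or> x = z \<or> y = z" if "adj v x" "adj v y" "adj v z" for v x y z
    using that by blast
  obtain c where c: "c \<in> C" using assms by blast
  have "\<exists>xs. distinct xs \<and> set xs = {w. adj c w} \<and> length xs \<le> 3"
  proof (cases "\<exists>x y. adj c x \<and> adj c y \<and> x \<noteq> y")
    case True
    then obtain x y where "adj c x" "adj c y" "x \<noteq> y" by blast
    then show ?thesis using two[of c x y] by (intro exI[of _ "[x, y]"]) auto
  next
    case False
    show ?thesis
    proof (cases "\<exists>x. adj c x")
      case True
      then obtain x where "adj c x" by blast
      then show ?thesis using False by (intro exI[of _ "[x]"]) auto
    qed (auto intro!: exI[of _ "[]"])
  qed
  then obtain s I where "arms c s I" using arms_of_neighbours by metis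
  then show ?thesis using c two by (intro dynkin_of_arms) blast+
qed

end

lemma component_dynkin_iff:
  assumes F: "F \<subseteq> C \<times> C" "C \<times> C \<subseteq> linked F" "C \<noteq> {}"
  shows "finitely_positive C F \<longleftrightarrow> dynkin (graph_on C F)"
proof
  assume "finitely_positive C F"
  then interpret positive_graph C F using F by unfold_locales
  show "dynkin (graph_on C F)" using F(3) by (rule positive_is_dynkin)
qed (use dynkin_finitely_positive F in blast)

theorem proposition7p3:
  fixes \<Omega> :: "'v pair_pre_digraph"
  assumes "pair_wf_digraph \<Omega>"
  shows "tits_positive_definite (with_proj \<Omega>) \<longleftrightarrow>
    (\<forall>K \<in> components (with_proj \<Omega>).
        (\<exists>n\<ge>1. has_underlying_graph K (A_graph n)) \<or>
        (\<exists>n\<ge>4. has_underlying_graph K (D_graph n)) \<or>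
        has_underlying_graph K (E_graph 6) \<or>
        has_underlying_graph K (E_graph 7) \<or>
        has_underlying_graph K (E_graph 8) \<or>
        has_underlying_graph K A_inf_graph \<or>
        has_underlying_graph K A_inf_inf_graph \<or>
        has_underlying_graph K D_inf_graph)"
proof -
  let ?V = "pverts \<Omega>" and ?E = "parcs \<Omega>"
  have \<Omega>: "with_proj \<Omega> = graph_on ?V ?E"
    by (simp add: with_proj_def graph_on_def)
  have "wf_digraph (graph_on ?V ?E)"
    using assms by (simp only: \<Omega>[symmetric] wf_digraph_wp_iff)
  then have wf: "?E \<subseteq> ?V \<times> ?V" by simp
  have "finitely_positive (linked ?E `` {u}) ?E \<longleftrightarrow> dynkin (component_of ?E u)" for u
  proof -
    let ?C = "linked ?E `` {u}"
    have "finitely_positive ?C ?E \<longleftrightarrow> finitely_positive ?C (arcs_in ?E ?C)"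
    proof
      assume a: "finitely_positive ?C (arcs_in ?E ?C)"
      show "finitely_positive ?C ?E"
        unfolding finitely_positive_def
      proof (intro allI impI)
        fix S and n :: "'v \<Rightarrow> int" assume S: "finite S \<and> S \<subseteq> ?C \<and> (\<exists>i\<in>S. n i \<noteq> 0)"
        then have "tits_sum ?E S n = tits_sum (arcs_in ?E ?C) S n"
          by (intro tits_sum_cong) auto
        with S a show "0 < tits_sum ?E S n" by (simp add: finitely_positive_def)
      qed
    qed (auto intro: finitely_positive_mono)
    also have "\<dots> \<longleftrightarrow> dynkin (component_of ?E u)"
      unfolding component_of_def
    proof (rule component_dynkin_iff)
      show "?C \<times> ?C \<subseteq> linked (arcs_in ?E ?C)"
        by (clarify, rule link_class_connected) simp_all
      show "?C \<noteq> {}" using linked_refl by fast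
    qed simp
    finally show ?thesis .
  qed
  then show ?thesis
    unfolding \<Omega> positive_definite_iff_components[OF wf] components_graph_on[OF wf] dynkin_def by simp
qed

end
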